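(* Let $\alpha\ge0$, let $d\ge1$ be an integer, and let $\alpha_1,\dots,\alpha_d$ be parameters with $-\alpha_j\notin\mathbb{N}=\{1,2,\dots\}$. Let $\{R_n\}_{n\ge0}$ be the reversed Appell monic $d$-orthogonal polynomial sequence $$R_n(x)=R_n(x;\alpha_1,\dots,\alpha_d)=\frac1{\lambda_n}\,{}_1F_d\left(\begin{matrix}-n\\ \alpha_1+1,\dots,\alpha_d+1\end{matrix};x\right),\qquad \lambda_n=(-1)^n\left(\prod_{\sigma=1}^d(\alpha_\sigma+1)_n\right)^{-1},\quad n\ge0,$$ with recurrence relation $$R_{n+2}(x)=(x-\beta_{n+1})R_{n+1}(x)-\sum_{\nu=0}^{d-1}\gamma_{n-\nu+1}^{d-1-\nu}R_{n-\nu}(x),\quad n\ge0,$$ and let $S_n(\cdot)=S_n(\cdot;\alpha,\alpha_1,\dots,\alpha_d)$ be the corresponding $KL_\alpha$-transformed sequence, $S_n\left(\frac{\tau^2}{4}\right)=KL_\alpha[R_n](\tau)$, that is, $$S_n\left(\tfrac{\tau^2}{4}\right)=\frac1{\lambda_n}\,{}_3F_d\left(\begin{matrix}-n,\ \alpha+1-\frac{i\tau}2,\ \alpha+1+\frac{i\tau}2\\ \alpha_1+1,\dots,\alpha_d+1\end{matrix};1\right),\quad n\ge0.$$ Then $\{S_n\}_{n\ge0}$ is a monic $\widetilde d$-orthogonal polynomial sequence, with $\widetilde d=2$ if $d=1$, $\widetilde d=1$ if $d=2$, and $\widetilde d=d$ if $d=3,4,5,\dots$. It fulfills the recurrence relation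 $$S_{n+2}\left(\tfrac{\tau^2}4\right)=\left(\tfrac{\tau^2}4-\widetilde\beta_{n+1}\right)S_{n+1}\left(\tfrac{\tau^2}4\right)-\sum_{\nu=0}^{\max(d-1,1)}\widetilde\gamma_{n-\nu+1}^{\,d-1-\nu}S_{n-\nu}\left(\tfrac{\tau^2}4\right),\quad n\ge0,$$ where $$\begin{aligned}\widetilde\beta_{n+1}&=\beta_{n+1}-(n+2+\alpha)^2,\\ \widetilde\gamma_{n+1}^{\,d-1}&=\gamma_{n+1}^{d-1}-(n+1)(2n+3+2\alpha)\prod_{\sigma=1}^d(n+1+\alpha_\sigma),\\ \widetilde\gamma_n^{\,d-2}&=\gamma_n^{d-2}-n(n+1)\prod_{\sigma=1}^d(n+1+\alpha_\sigma)(n+\alpha_\sigma),\\ \widetilde\gamma_{n-\nu+1}^{\,d-1-\nu}&=\gamma_{n-\nu+1}^{d-1-\nu},\quad \nu=2,3,\dots,d-1,\end{aligned}$$ with $\gamma_n^{-1}:=0$ when $d=1$. Moreover, setting $\widehat S_n\left(\frac{\tau^2}4;a,a_1,\dots,a_d\right):=S_n\left(\frac{\tau^2}4;a-1,a+a_1-1,\dots,a+a_d-1\right)$, one has $$\delta_i\widehat S_{n+1}\left(\tfrac{\tau^2}4;a,a_1,\dots,a_d\right)=(n+1)\,\widehat S_n\left(\tfrac{\tau^2}4;a+\tfrac12,a_1+\tfrac12,\dots,a_d+\tfrac12\right),\quad n\in\mathbb{N}_0,$$ where $\delta_\omega$ denotes the central difference operator $(\delta_\omega f)(\tau)=\dfrac{f(\tau+\omega)-f(\tau-\omega)}{2\omega\tau}$,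 $\omega\ne0$, acting with respect to $\tau$ (here $\omega=i$).
   Context: $\mathbb{N}_0=\{0,1,2,\dots\}$; $(x)_n=\prod_{\sigma=0}^{n-1}(x+\sigma)$, $(x)_0=1$; ${}_pF_q$ denotes the generalized hypergeometric series (here always terminating). Conventions: $R_{-k}=S_{-k}=0$ for $k\ge1$. Superscripts on $\gamma$ and $\widetilde\gamma$ are indices, not powers. For $\alpha\ge 0$ and $\tau>0$, $$KL_\alpha[f](\tau)=2\left|\Gamma\left(\alpha+1+\tfrac{i\tau}{2}\right)\right|^{-2}\int_0^\infty x^\alpha K_{i\tau}(2\sqrt{x})f(x)\,dx,$$ where $K_\nu$ is the modified Bessel (Macdonald) function. For polynomial $f$ the result is a polynomial in $\tau^2/4$ of the same degree (and is so regarded for complex $\tau$), with $KL_\alpha[x^n](\tau)=\left(\alpha+1-\frac{i\tau}{2}\right)_n\left(\alpha+1+\frac{i\tau}{2}\right)_n$. A monic polynomial sequence $\{P_n\}$ is Appell if $P_{n+1}'=(n+1)P_n$ for all $n\ge 0$; if moreover $P_n(0)\ne0$ for all $n$, then $R_n(x)=P_n(0)^{-1}x^nP_n(1/x)$ is called a reversed Appell sequence. It is known (Ben Cheikh and Douak) that, up to a linear change of variable, the reversed Appell monic $d$-orthogonal sequences are exactly the sequences $R_n(\cdot;\alpha_1,\dots,\alpha_d)$ of the claim. For a positive integer $m$, a polynomial sequence $\{P_n\}_{n\ge0}$ with $\deg P_n=n$ is $m$-orthogonal if there are linear functionals $w_0,\dots,w_{m-1}$ on the space of complex polynomials such that for each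 $k=0,\dots,m-1$: $\langle w_k,x^jP_n\rangle=0$ for $n\ge jm+k+1$, $j\ge0$, and $\langle w_k,x^jP_{jm+k}\rangle\ne0$ for $j\ge0$. For $m=1$ this is ordinary orthogonality.
   Formalization: For d=2, orthogonality is claimed only if n+α₁+α₂−2α≠0 for all n≥0 (it fails otherwise, e.g. α=α₁=α₂=0), and the factor (n+1) in the δ_i relation is corrected to (n+1)/2, since δ_i(τ²/4)=1/2. *)

theory Defs
  imports "HOL-Analysis.Analysis"
begin

section \<open>The Kontorovich-Lebedev transform\<close>

text \<open>Modified Bessel (Macdonald) function of complex order at a positive real argument,
  by its classical integral \<open>K\<^sub>\<nu>(x) = \<integral>\<^sub>0\<^sup>\<infinity> exp (- x cosh t) cosh (\<nu> t) dt\<close>, \<open>x > 0\<close>.\<close>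

definition Macdonald_K :: "complex \<Rightarrow> real \<Rightarrow> complex" where
  "Macdonald_K \<nu> x = (LBINT t:{0<..}. of_real (exp (- x * cosh t)) * cosh (\<nu> * of_real t))"

definition KL :: "real \<Rightarrow> (real \<Rightarrow> complex) \<Rightarrow> real \<Rightarrow> complex" where
  "KL \<alpha> f \<tau> =
     2 * of_real (inverse ((cmod (Gamma (of_real \<alpha> + 1 + \<i> * of_real \<tau> / 2)))\<^sup>2)) *
     (LBINT x:{0<..}. of_real (x powr \<alpha>) * Macdonald_K (\<i> * of_real \<tau>) (2 * sqrt x) * f x)"

text \<open>For a polynomial \<open>f\<close>, the transform is a polynomial in \<open>\<tau>\<^sup>2/4\<close> on \<open>\<tau> > 0\<close>; this is that
  polynomial. It is unique since \<open>\<tau>\<^sup>2/4\<close> takes infinitely many values; existence is part of the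
  conclusion of the theorem for the polynomials considered there. Evaluating it at complex arguments
  gives the extension of the transform to complex \<open>\<tau>\<close>.\<close>

definition KL_poly :: "real \<Rightarrow> complex poly \<Rightarrow> complex poly" where
  "KL_poly \<alpha> f = (THE p. \<forall>\<tau>>0. poly p (of_real (\<tau>\<^sup>2 / 4)) = KL \<alpha> (\<lambda>x. poly f (of_real x)) \<tau>)"

section \<open>The polynomial sequences\<close>

text \<open>Generalized hypergeometric series; it is only used with an upper parameter \<open>- n\<close>, that is,
  terminating.\<close>

definition pFq :: "complex list \<Rightarrow> complex list \<Rightarrow> complex \<Rightarrow> complex" where
  "pFq as bs z = eval_fps (fps_hypergeo as bs 1) z"

text \<open>The parameters \<open>\<alpha>\<^sub>1, \<dots>, \<alpha>\<^sub>d\<close> form a list of length \<open>d\<close>.\<close>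

definition lam :: "complex list \<Rightarrow> nat \<Rightarrow> complex" where
  "lam \<alpha>s n = (- 1) ^ n * inverse (\<Prod>a\<leftarrow>\<alpha>s. pochhammer (a + 1) n)"

text \<open>The series terminates at the index \<open>n\<close>; see \<open>poly_R\<close> below for the closed form.\<close>

definition R :: "complex list \<Rightarrow> nat \<Rightarrow> complex poly" where
  "R \<alpha>s n = smult (1 / lam \<alpha>s n)
     (\<Sum>k\<le>n. monom (fps_nth (fps_hypergeo [- of_nat n] (map (\<lambda>a. a + 1) \<alpha>s) 1) k) k)"

lemma poly_R:
  "poly (R \<alpha>s n) x = 1 / lam \<alpha>s n * pFq [- of_nat n] (map (\<lambda>a. a + 1) \<alpha>s) x"
proof -
  let ?c = "fps_nth (fps_hypergeo [- of_nat n] (map (\<lambda>a. a + 1) \<alpha>s) (1::complex))"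
  have "(\<lambda>k. ?c k * x ^ k) sums (\<Sum>k\<le>n. ?c k * x ^ k)"
    by (rule sums_finite) (auto simp: pochhammer_of_nat_eq_0_lemma)
  then show ?thesis
    by (simp only: R_def pFq_def eval_fps_def poly_smult poly_sum poly_monom sums_iff)
qed

definition S :: "real \<Rightarrow> complex list \<Rightarrow> nat \<Rightarrow> complex poly" where
  "S \<alpha> \<alpha>s n = KL_poly \<alpha> (R \<alpha>s n)"

definition S_hat :: "real \<Rightarrow> complex list \<Rightarrow> nat \<Rightarrow> complex poly" where
  "S_hat a as n = S (a - 1) (map (\<lambda>b. of_real a + b - 1) as) n"

section \<open>Multiple orthogonality\<close>

definition m_orthogonal :: "nat \<Rightarrow> (nat \<Rightarrow> complex poly) \<Rightarrow> bool" where
  "m_orthogonal m P \<longleftrightarrow>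
     m \<ge> 1 \<and> (\<forall>n. P n \<noteq> 0 \<and> degree (P n) = n) \<and>
     (\<exists>w :: nat \<Rightarrow> complex poly \<Rightarrow> complex.
        (\<forall>k<m. Vector_Spaces.linear smult (*) (w k)) \<and>
        (\<forall>k<m. \<forall>j. (\<forall>n \<ge> j * m + k + 1. w k (monom 1 j * P n) = 0) \<and>
                    w k (monom 1 j * P (j * m + k)) \<noteq> 0))"

definition d_tilde :: "nat \<Rightarrow> nat" where
  "d_tilde d = (if d = 1 then 2 else if d = 2 then 1 else d)"

text \<open>For \<open>d = 2\<close> the transformed polynomials are continuous dual Hahn polynomials. They satisfy
  a three-term recurrence whose last coefficient is
  \<open>(n + 1) (n + 1 + \<alpha>\<^sub>1) (n + 1 + \<alpha>\<^sub>2) (n + \<alpha>\<^sub>1 + \<alpha>\<^sub>2 - 2 \<alpha>)\<close>, and they are orthogonal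
  with respect to a regular functional precisely when it vanishes for no \<open>n \<ge> 0\<close>. For all other
  \<open>d\<close> there is no such restriction.\<close>

definition regular_parameters :: "real \<Rightarrow> complex list \<Rightarrow> bool" where
  "regular_parameters \<alpha> \<alpha>s \<longleftrightarrow>
     (length \<alpha>s = 2 \<longrightarrow> (\<forall>n::nat. of_nat n + sum_list \<alpha>s - 2 * of_real \<alpha> \<noteq> 0))"

section \<open>Central differences\<close>

text \<open>Meaningful for \<open>\<omega> \<noteq> 0\<close> and \<open>\<tau> \<noteq> 0\<close>. Note that \<open>\<tau>\<^sup>2\<close> is mapped to the constant
  \<open>2\<close>, so the function \<open>\<tau>\<^sup>2/4\<close> is mapped to \<open>1/2\<close>.\<close>

definition central_diff :: "complex \<Rightarrow> (complex \<Rightarrow> complex) \<Rightarrow> complex \<Rightarrow> complex" where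
  "central_diff \<omega> f \<tau> = (f (\<tau> + \<omega>) - f (\<tau> - \<omega>)) / (2 * \<omega> * \<tau>)"

end

theory Submission
  imports Defs
begin

text \<open>With \<open>x = e\<^sup>t\<close>, the Mellin transform of \<open>K\<^sub>i\<^sub>\<tau>(2 \<surd>x)\<close> becomes, by the unimodular substitution
  \<open>v = t/2 + u\<close>, \<open>w = t/2 - u\<close>, the product of two Gamma integrals in \<open>v\<close> and \<open>w\<close>. Hence on
  polynomials the transform is the linear map \<open>L\<close> sending \<open>x\<^sup>k\<close> to \<open>q\<^sub>k(z) = \<Prod>\<^sub>j\<^sub><\<^sub>k (z + (\<alpha> + 1 + j)\<^sup>2)\<close>, \<open>z = \<tau>\<^sup>2/4\<close>.
  Since \<open>z q\<^sub>k = q\<^sub>k\<^sub>+\<^sub>1 - (\<alpha> + 1 + k)\<^sup>2 q\<^sub>k\<close>, we have \<open>z L p = L (x p - (\<theta> + \<alpha> + 1)\<^sup>2 p)\<close> with \<open>\<theta> = x d/dx\<close>, and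
  \<open>\<theta> R\<^sub>n\<close> is a combination of \<open>R\<^sub>n\<close> and \<open>R\<^sub>n\<^sub>-\<^sub>1\<close>; this turns the recurrence of the \<open>R\<^sub>n\<close> into that of the \<open>S\<^sub>n\<close>.
  Multiple orthogonality holds for the dual basis of the \<open>S\<^sub>n\<close> as soon as the lowest recurrence
  coefficient never vanishes. The central difference operator intertwines \<open>L\<close> with \<open>d/dx\<close>, shifting \<open>\<alpha>\<close> by \<open>1/2\<close>,
  and \<open>R\<^sub>n\<^sub>+\<^sub>1'\<close> is a multiple of \<open>R\<^sub>n\<close> with all parameters raised by one.\<close>

section \<open>Mellin transform of the Macdonald function\<close>

lemma borel_measurable_cosh [measurable]:
  "(cosh :: 'a::{banach, real_normed_field} \<Rightarrow> 'a) \<in> borel_measurable borel"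
  by (intro borel_measurable_continuous_onI continuous_intros)

lemma borel_measurable_exp' [measurable]:
  "(exp :: 'a::{banach, real_normed_field} \<Rightarrow> 'a) \<in> borel_measurable borel"
  by (intro borel_measurable_continuous_onI continuous_intros)

lemma borel_measurable_complex_of_real [measurable]: "complex_of_real \<in> borel_measurable borel"
  by (intro borel_measurable_continuous_onI continuous_intros)

lemma integral_exp_substitution_real:
  fixes H :: "real \<Rightarrow> real"
  assumes [measurable]: "H \<in> borel_measurable borel"
  shows "set_integrable lborel {0<..} H \<longleftrightarrow> integrable lborel (\<lambda>t. exp t * H (exp t))"
    and "set_integrable lborel {0<..} H \<Longrightarrow>
      (LBINT x:{0<..}. H x) = (\<integral>t. exp t * H (exp t) \<partial>lborel)"
proof -
  have ran: "range (exp :: real \<Rightarrow> real) = {0<..}"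
    by (auto simp: image_iff) (metis exp_ln)
  \<comment> \<open>The change of variables theorem speaks of Lebesgue measure, the completion of
    \<open>lborel\<close>; for Borel functions the two notions of integrability agree.\<close>
  have leb: "G absolutely_integrable_on A \<longleftrightarrow> set_integrable lborel A G"
    if "G \<in> borel_measurable borel" "A \<in> sets borel" for G :: "real \<Rightarrow> real" and A
    unfolding set_integrable_def using that by (subst integrable_completion) auto
  have cv: "(\<lambda>x. \<bar>exp x\<bar> * H (exp x)) absolutely_integrable_on UNIV \<and>
      integral UNIV (\<lambda>x. \<bar>exp x\<bar> * H (exp x)) = b \<longleftrightarrow>
      H absolutely_integrable_on {0<..} \<and> integral {0<..} H = b" for b
    using has_absolute_integral_change_of_variables_1'[of UNIV exp exp H b, unfolded ran]
    by (auto intro: DERIV_subset derivative_eq_intros inj_onI)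
  have i1: "H absolutely_integrable_on {0<..} \<longleftrightarrow> set_integrable lborel {0<..} H"
    by (rule leb) auto
  have i2: "(\<lambda>x. \<bar>exp x\<bar> * H (exp x)) absolutely_integrable_on UNIV \<longleftrightarrow>
      integrable lborel (\<lambda>t. exp t * H (exp t))"
    by (subst leb) (auto simp: set_integrable_def)
  show eq: "set_integrable lborel {0<..} H \<longleftrightarrow> integrable lborel (\<lambda>t. exp t * H (exp t))"
    using cv i1 i2 by blast
  assume int: "set_integrable lborel {0<..} H"
  then have int': "set_integrable lborel UNIV (\<lambda>t. exp t * H (exp t))"
    using eq by (simp add: set_integrable_def)
  have "(LBINT x:{0<..}. H x) = integral {0<..} H"
    using set_borel_integral_eq_integral(2)[OF int] .
  also have "\<dots> = integral UNIV (\<lambda>x. exp x * H (exp x))"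
    using cv[of "integral {0<..} H"] int i1 by simp
  also have "\<dots> = (LBINT t:UNIV. exp t * H (exp t))"
    using set_borel_integral_eq_integral(2)[OF int'] by simp
  finally show "(LBINT x:{0<..}. H x) = (\<integral>t. exp t * H (exp t) \<partial>lborel)"
    by (simp add: set_lebesgue_integral_def)
qed

lemma integrable_complex_iff:
  fixes f :: "'a \<Rightarrow> complex"
  shows "integrable M f \<longleftrightarrow> integrable M (\<lambda>x. Re (f x)) \<and> integrable M (\<lambda>x. Im (f x))"
proof
  assume *: "integrable M (\<lambda>x. Re (f x)) \<and> integrable M (\<lambda>x. Im (f x))"
  have "integrable M (\<lambda>x. of_real (Re (f x)) + \<i> * of_real (Im (f x)))"
    using * by (intro Bochner_Integration.integrable_add integrable_mult_right integrable_of_real) auto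
  then show "integrable M f" by (simp flip: complex_eq)
qed auto

lemma integral_exp_substitution:
  fixes H :: "real \<Rightarrow> complex"
  assumes [measurable]: "H \<in> borel_measurable borel"
  shows "set_integrable lborel {0<..} H \<longleftrightarrow> integrable lborel (\<lambda>t. of_real (exp t) * H (exp t))"
    and "set_integrable lborel {0<..} H \<Longrightarrow>
      (LBINT x:{0<..}. H x) = (\<integral>t. of_real (exp t) * H (exp t) \<partial>lborel)"
proof -
  have set_iff: "set_integrable lborel {0<..} H \<longleftrightarrow>
    set_integrable lborel {0<..} (\<lambda>x. Re (H x)) \<and> set_integrable lborel {0<..} (\<lambda>x. Im (H x))"
    unfolding set_integrable_def by (subst integrable_complex_iff) simp
  have iff: "integrable lborel (\<lambda>t. of_real (exp t) * H (exp t)) \<longleftrightarrow>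
    integrable lborel (\<lambda>t. exp t * Re (H (exp t))) \<and> integrable lborel (\<lambda>t. exp t * Im (H (exp t)))"
    by (subst integrable_complex_iff) simp
  show eq: "set_integrable lborel {0<..} H \<longleftrightarrow> integrable lborel (\<lambda>t. of_real (exp t) * H (exp t))"
    unfolding set_iff iff
    using integral_exp_substitution_real(1)[of "\<lambda>x. Re (H x)"]
      integral_exp_substitution_real(1)[of "\<lambda>x. Im (H x)"] by simp
  assume int: "set_integrable lborel {0<..} H"
  with eq have int': "integrable lborel (\<lambda>t. of_real (exp t) * H (exp t))" by blast
  have parts: "set_integrable lborel {0<..} (\<lambda>x. Re (H x))" "set_integrable lborel {0<..} (\<lambda>x. Im (H x))"
    using int set_iff by auto
  have "Re (LBINT x:{0<..}. H x) = (LBINT x:{0<..}. Re (H x))"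
    using int unfolding set_integrable_def set_lebesgue_integral_def
    by (subst integral_Re[symmetric]) auto
  moreover have "Im (LBINT x:{0<..}. H x) = (LBINT x:{0<..}. Im (H x))"
    using int unfolding set_integrable_def set_lebesgue_integral_def
    by (subst integral_Im[symmetric]) auto
  moreover have "Re (\<integral>t. of_real (exp t) * H (exp t) \<partial>lborel) = (\<integral>t. exp t * Re (H (exp t)) \<partial>lborel)"
    using int' by (subst integral_Re[symmetric]) auto
  moreover have "Im (\<integral>t. of_real (exp t) * H (exp t) \<partial>lborel) = (\<integral>t. exp t * Im (H (exp t)) \<partial>lborel)"
    using int' by (subst integral_Im[symmetric]) auto
  ultimately show "(LBINT x:{0<..}. H x) = (\<integral>t. of_real (exp t) * H (exp t) \<partial>lborel)"
    using integral_exp_substitution_real(2)[OF _ parts(1)]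
      integral_exp_substitution_real(2)[OF _ parts(2)] by (auto intro: complex_eqI)
qed

text \<open>Euler's integral after the substitution t = exp v; the Jacobian exp v turns the exponent
  a - 1 into a.\<close>

lemma Gamma_integral_exp:
  fixes a :: complex
  assumes "Re a > 0"
  shows "integrable lborel (\<lambda>v::real. exp (a * of_real v - of_real (exp v)))"
    and "(\<integral>v. exp (a * of_real v - of_real (exp v)) \<partial>lborel) = Gamma a"
proof -
  \<comment> \<open>On t > 0 this is the Euler integrand t powr (a - 1) / exp t; the real logarithm
    makes measurability on the whole line immediate.\<close>
  define H where "H = (\<lambda>t::real. exp ((a - 1) * of_real (ln t)) / of_real (exp t) :: complex)"
  have [measurable]: "H \<in> borel_measurable borel"
    unfolding H_def by measurable
  have eq: "of_real (exp v) * H (exp v) = exp (a * of_real v - of_real (exp v))" for v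
    by (simp add: H_def exp_diff exp_of_real ring_distribs)
  have H_powr: "H t = of_real t powr (a - 1) / of_real (exp t)" if "t \<in> {0<..}" for t
    using that by (simp add: H_def powr_def Ln_of_real)
  have "H absolutely_integrable_on {0<..}"
    using absolutely_integrable_Gamma_integral'[OF assms] H_powr
    by (subst set_integrable_cong[OF refl refl]) auto
  then have int: "set_integrable lborel {0<..} H"
    unfolding set_integrable_def by (subst (asm) integrable_completion) auto
  show "integrable lborel (\<lambda>v::real. exp (a * of_real v - of_real (exp v)))"
    using int integral_exp_substitution(1)[of H] by (simp add: eq)
  have "(LBINT x:{0<..}. H x) = Gamma a"
    unfolding set_borel_integral_eq_integral(2)[OF int]
      integral_unique[OF Gamma_integral_complex'[OF assms], symmetric]
    by (rule Henstock_Kurzweil_Integration.integral_cong) (rule H_powr)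
  then show "(\<integral>v. exp (a * of_real v - of_real (exp v)) \<partial>lborel) = Gamma a"
    using integral_exp_substitution(2)[OF _ int] by (simp add: eq)
qed

text \<open>For fixed x the map y \<mapsto> g x + c y is affine with slope of modulus 1, hence
  preserves the inner integral; Fubini does the rest. Two such shears make up the unimodular
  substitution of the Mellin transform.\<close>

lemma lborel_pair_shear:
  fixes f :: "real \<times> real \<Rightarrow> 'b::{banach, second_countable_topology}"
  assumes int: "integrable (lborel \<Otimes>\<^sub>M lborel) f"
    and [measurable]: "g \<in> borel_measurable borel" and c: "\<bar>c\<bar> = 1"
  shows "integrable (lborel \<Otimes>\<^sub>M lborel) (\<lambda>(x, y). f (x, g x + c * y))"
    and "(\<integral>(x, y). f (x, g x + c * y) \<partial>(lborel \<Otimes>\<^sub>M lborel)) = integral\<^sup>L (lborel \<Otimes>\<^sub>M lborel) f"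
proof -
  have [measurable]: "f \<in> borel_measurable (lborel \<Otimes>\<^sub>M lborel)"
    using int by (rule borel_measurable_integrable)
  have c0: "c \<noteq> 0" using c by auto
  show int': "integrable (lborel \<Otimes>\<^sub>M lborel) (\<lambda>(x, y). f (x, g x + c * y))"
  proof (rule lborel_pair.Fubini_integrable)
    show "AE x in lborel. integrable lborel (\<lambda>y. case (x, y) of (x, y) \<Rightarrow> f (x, g x + c * y))"
      using lborel_pair.AE_integrable_fst'[OF int]
    proof eventually_elim
      case (elim x)
      then show ?case
        using lborel_integrable_real_affine[OF elim c0, of "g x"] by simp
    qed
    have "(\<integral>y. norm (f (x, g x + c * y)) \<partial>lborel) = (\<integral>y. norm (f (x, y)) \<partial>lborel)" for x
      using lborel_integral_real_affine[OF c0, of "\<lambda>y. norm (f (x, y))" "g x"] c by simp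
    then show "integrable lborel (\<lambda>x. \<integral>y. norm (case (x, y) of (x, y) \<Rightarrow> f (x, g x + c * y)) \<partial>lborel)"
      using lborel_pair.integrable_fst'[OF integrable_norm[OF int]] by simp
  qed measurable
  have "(\<integral>y. f (x, g x + c * y) \<partial>lborel) = (\<integral>y. f (x, y) \<partial>lborel)" for x
    using lborel_integral_real_affine[OF c0, of "\<lambda>y. f (x, y)" "g x"] c by simp
  then show "(\<integral>(x, y). f (x, g x + c * y) \<partial>(lborel \<Otimes>\<^sub>M lborel)) = integral\<^sup>L (lborel \<Otimes>\<^sub>M lborel) f"
    using lborel_pair.integral_fst'[OF int'] lborel_pair.integral_fst'[OF int] by simp
qed

text \<open>The dominating function is a multiple of the integrand exp (v - exp v) of Gamma 1,
  translated by ln (x/2).\<close>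

lemma integrable_exp_cosh:
  fixes x :: real
  assumes "x > 0"
  shows "integrable lborel (\<lambda>u. exp (- x * cosh u))"
proof -
  have "integrable lborel (\<lambda>v. exp (1 * complex_of_real v - of_real (exp v)))"
    by (rule Gamma_integral_exp) simp
  then have "integrable lborel (\<lambda>v. norm (exp (1 * complex_of_real v - of_real (exp v))))"
    by (rule integrable_norm)
  then have "integrable lborel (\<lambda>v::real. exp (v - exp v))"
    by (simp add: norm_exp_eq_Re)
  then have "integrable lborel (\<lambda>u. exp (ln (x / 2) + 1 * u - exp (ln (x / 2) + 1 * u)))"
    by (rule lborel_integrable_real_affine) simp
  then have "integrable lborel (\<lambda>u. 4 / x\<^sup>2 * exp (ln (x / 2) + 1 * u - exp (ln (x / 2) + 1 * u)))"
    by (rule integrable_mult_right)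
  then show ?thesis
  proof (rule Bochner_Integration.integrable_bound)
    show "AE u in lborel. norm (exp (- x * cosh u)) \<le>
      norm (4 / x\<^sup>2 * exp (ln (x / 2) + 1 * u - exp (ln (x / 2) + 1 * u)))"
    proof (rule AE_I2)
      fix u
      \<comment> \<open>Here x cosh u = s + (x/2) exp u. The bound exp (-s) \<le> 1/s trades the
        decay of the s-part for a factor exp u, which is the one needed for the Gamma
        integrand.\<close>
      define s where "s = x * exp (- u) / 2"
      have s: "s > 0" using assms by (simp add: s_def)
      have "s * exp (- s) \<le> exp s * exp (- s)"
        using exp_ge_add_one_self[of s] by (intro mult_right_mono) (auto intro: order_trans[OF _ exp_ge_add_one_self])
      then have le: "exp (- s) \<le> 2 * exp u / x"
        using s assms by (simp add: s_def exp_minus field_simps)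
      have "exp (- x * cosh u) = exp (- s) * exp (- (x / 2 * exp u))"
        unfolding s_def exp_add[symmetric] by (simp add: cosh_def algebra_simps)
      also have "\<dots> \<le> 2 * exp u / x * exp (- (x / 2 * exp u))"
        using le by (intro mult_right_mono) auto
      also have "\<dots> = 4 / x\<^sup>2 * (x / 2 * exp u * exp (- (x / 2 * exp u)))"
        using assms by (simp add: power2_eq_square)
      also have "x / 2 * exp u * exp (- (x / 2 * exp u)) =
          exp (ln (x / 2) + 1 * u - exp (ln (x / 2) + 1 * u))"
        using assms by (simp only: exp_diff exp_add exp_minus divide_inverse exp_ln mult_1) simp
      finally show "norm (exp (- x * cosh u)) \<le>
          norm (4 / x\<^sup>2 * exp (ln (x / 2) + 1 * u - exp (ln (x / 2) + 1 * u)))"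
        by simp
    qed
  qed measurable
qed

text \<open>Reflecting the negative half-line pairs exp (i \<tau> u) with exp (-i \<tau> u), and
  their sum is twice the hyperbolic cosine in the definition of K.\<close>

lemma Macdonald_K_full_line:
  assumes "x > 0"
  shows "(\<integral>u. of_real (exp (- x * cosh u)) * exp (\<i> * of_real (\<tau> * u)) \<partial>lborel) =
      2 * Macdonald_K (\<i> * of_real \<tau>) x"
proof -
  define g where "g u = of_real (exp (- x * cosh u)) * exp (\<i> * of_real (\<tau> * u))" for u
  have [measurable]: "g \<in> borel_measurable borel"
    unfolding g_def by measurable
  have g: "integrable lborel g"
    by (rule Bochner_Integration.integrable_bound[OF integrable_exp_cosh[OF assms]])
       (auto simp: g_def norm_mult norm_exp_eq_Re)
  have ind: "integrable lborel (\<lambda>u. indicator {0<..} u *\<^sub>R g u)" "integrable lborel (\<lambda>u. indicator {..<0} u *\<^sub>R g u)"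
    by (auto intro: integrable_mult_indicator g)
  have neg: "(\<lambda>u. indicator {..<0} (0 + (- 1) * u) *\<^sub>R g (0 + (- 1) * u)) = (\<lambda>u. indicator {0<..} u *\<^sub>R g (- u))"
    by (auto simp: indicator_def)
  have ind': "integrable lborel (\<lambda>u. indicator {0<..} u *\<^sub>R g (- u))"
    using lborel_integrable_real_affine[OF ind(2), of "- 1" 0] unfolding neg by simp
  have "integral\<^sup>L lborel g = (\<integral>u. indicator {0<..} u *\<^sub>R g u + indicator {..<0} u *\<^sub>R g u \<partial>lborel)"
  proof (rule integral_cong_AE)
    \<comment> \<open>The two open half-lines miss only the null set {0}.\<close>
    show "AE u in lborel. g u = indicator {0<..} u *\<^sub>R g u + indicator {..<0} u *\<^sub>R g u"
      using AE_lborel_singleton[of "0::real"]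
      by eventually_elim (auto simp: indicator_def)
  qed measurable
  also have "\<dots> = (\<integral>u. indicator {0<..} u *\<^sub>R g u \<partial>lborel) + (\<integral>u. indicator {..<0} u *\<^sub>R g u \<partial>lborel)"
    using ind by simp
  also have "(\<integral>u. indicator {..<0} u *\<^sub>R g u \<partial>lborel) = (\<integral>u. indicator {0<..} u *\<^sub>R g (- u) \<partial>lborel)"
    using lborel_integral_real_affine[of "- 1" "\<lambda>u. indicator {..<0} u *\<^sub>R g u" 0] unfolding neg by simp
  also have "(\<integral>u. indicator {0<..} u *\<^sub>R g u \<partial>lborel) + (\<integral>u. indicator {0<..} u *\<^sub>R g (- u) \<partial>lborel) =
      (\<integral>u. indicator {0<..} u *\<^sub>R g u + indicator {0<..} u *\<^sub>R g (- u) \<partial>lborel)"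
    using ind(1) ind' by simp
  also have "\<dots> = (\<integral>u. 2 * (indicator {0<..} u *\<^sub>R
      (of_real (exp (- x * cosh u)) * cosh (\<i> * of_real \<tau> * of_real u))) \<partial>lborel)"
    by (intro Bochner_Integration.integral_cong refl)
       (auto simp: indicator_def g_def cosh_def scaleR_conv_of_real algebra_simps)
  also have "\<dots> = 2 * Macdonald_K (\<i> * of_real \<tau>) x"
    unfolding Macdonald_K_def set_lebesgue_integral_def by (rule integral_mult_right_zero)
  finally show ?thesis by (simp add: g_def)
qed

text \<open>With t = v + w and u = (v - w)/2 the exponents of the two Gamma integrands combine: a v
  + b w = c t + i \<tau> u and exp v + exp w = 2 exp (t/2) cosh u.\<close>

lemma Gamma_product_shifted:
  fixes c \<tau> :: real
  assumes "c > 0"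
  defines "F \<equiv> \<lambda>t u::real. of_real (exp (c * t)) *
      (of_real (exp (- 2 * exp (t / 2) * cosh u)) * exp (\<i> * of_real (\<tau> * u)))"
  shows "integrable (lborel \<Otimes>\<^sub>M lborel) (\<lambda>(t, u). F t u)"
    and "(\<integral>(t, u). F t u \<partial>(lborel \<Otimes>\<^sub>M lborel)) =
      Gamma (of_real c + \<i> * of_real \<tau> / 2) * Gamma (of_real c - \<i> * of_real \<tau> / 2)"
proof -
  define a b :: complex where "a = of_real c + \<i> * of_real \<tau> / 2" and "b = of_real c - \<i> * of_real \<tau> / 2"
  have ab: "Re a > 0" "Re b > 0" using assms by (auto simp: a_def b_def)
  define e where "e = (\<lambda>(a::complex) (v::real). exp (a * of_real v - of_real (exp v)))"
  have [measurable]: "e a \<in> borel_measurable borel" for a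
    unfolding e_def by measurable
  have e_int: "integrable lborel (e a)" "integrable lborel (e b)"
    and e_Gamma: "integral\<^sup>L lborel (e a) = Gamma a" "integral\<^sup>L lborel (e b) = Gamma b"
    using Gamma_integral_exp[OF ab(1)] Gamma_integral_exp[OF ab(2)] by (simp_all add: e_def)
  have int0: "integrable (lborel \<Otimes>\<^sub>M lborel) (\<lambda>(v, w). e a v * e b w)"
    by (rule lborel_pair.Fubini_integrable)
       (auto simp: norm_mult intro!: e_int integrable_norm integrable_mult_left)
  have val0: "(\<integral>(v, w). e a v * e b w \<partial>(lborel \<Otimes>\<^sub>M lborel)) = Gamma a * Gamma b"
    using lborel_pair.integral_fst'[OF int0] by (simp add: e_Gamma)
  \<comment> \<open>First shear: w = t - v with v fixed.\<close>
  note shear1 = lborel_pair_shear[OF int0, of "\<lambda>v. - v" 1]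
  have int1: "integrable (lborel \<Otimes>\<^sub>M lborel) (\<lambda>(v, t). e a v * e b (t - v))"
    and val1: "(\<integral>(v, t). e a v * e b (t - v) \<partial>(lborel \<Otimes>\<^sub>M lborel)) = Gamma a * Gamma b"
    using shear1 val0 by (simp_all add: case_prod_beta)
  have int2: "integrable (lborel \<Otimes>\<^sub>M lborel) (\<lambda>(t, v). e a v * e b (t - v))"
    using lborel_pair.integrable_product_swap[OF int1] by simp
  have val2: "(\<integral>(t, v). e a v * e b (t - v) \<partial>(lborel \<Otimes>\<^sub>M lborel)) = Gamma a * Gamma b"
    using lborel_pair.integral_product_swap[of "\<lambda>(v, t). e a v * e b (t - v)"] int1 val1
    by (simp add: borel_measurable_integrable)
  \<comment> \<open>Second shear, after exchanging the variables: v = t/2 + u with t fixed.\<close>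
  have "(\<lambda>t::real. t / 2) \<in> borel_measurable borel" by measurable
  note shear2 = lborel_pair_shear[OF int2 this, of 1]
  have exp_split: "exp (of_real A + Z - of_real D) = of_real (exp A) * (of_real (exp (- D)) * exp Z)"
    for A D :: real and Z :: complex
    unfolding exp_of_real[symmetric] by (simp add: algebra_simps flip: exp_add)
  have F: "e a (t / 2 + u) * e b (t - (t / 2 + u)) = F t u" for t u
  proof -
    have ex: "exp (t / 2 + u) + exp (t - (t / 2 + u)) = 2 * exp (t / 2) * cosh u"
      by (simp add: cosh_def algebra_simps flip: exp_add exp_diff)
    have "e a (t / 2 + u) * e b (t - (t / 2 + u)) =
      exp (a * of_real (t / 2 + u) + b * of_real (t - (t / 2 + u))
         - of_real (exp (t / 2 + u) + exp (t - (t / 2 + u))))"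
      unfolding e_def by (simp add: algebra_simps flip: exp_add)
    also have "a * of_real (t / 2 + u) + b * of_real (t - (t / 2 + u)) = of_real (c * t) + \<i> * of_real (\<tau> * u)"
      by (simp add: a_def b_def field_simps)
    also have "exp (of_real (c * t) + \<i> * of_real (\<tau> * u)
        - of_real (exp (t / 2 + u) + exp (t - (t / 2 + u)))) = F t u"
      unfolding ex F_def exp_split by simp
    finally show ?thesis .
  qed
  show "integrable (lborel \<Otimes>\<^sub>M lborel) (\<lambda>(t, u). F t u)"
    using shear2(1)[OF abs_one] by (simp only: case_prod_conv mult_1 F)
  show "(\<integral>(t, u). F t u \<partial>(lborel \<Otimes>\<^sub>M lborel)) =
      Gamma (of_real c + \<i> * of_real \<tau> / 2) * Gamma (of_real c - \<i> * of_real \<tau> / 2)"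
    using shear2(2)[OF abs_one] val2 by (simp only: case_prod_conv mult_1 F) (simp only: a_def b_def)
qed

lemma borel_measurable_Macdonald_K [measurable]: "Macdonald_K \<nu> \<in> borel_measurable borel"
  unfolding Macdonald_K_def set_lebesgue_integral_def
  by measurable

text \<open>After x = exp t, where sqrt x = exp (t/2), the Macdonald function is half of the inner
  u-integral of \<open>Gamma_product_shifted\<close>, so Fubini yields both integrability and the
  value.\<close>

lemma Macdonald_K_Mellin:
  fixes c \<tau> :: real
  assumes "c > 0"
  shows "set_integrable lborel {0<..}
      (\<lambda>x. of_real (x powr (c - 1)) * Macdonald_K (\<i> * of_real \<tau>) (2 * sqrt x))"
    and "(LBINT x:{0<..}. of_real (x powr (c - 1)) * Macdonald_K (\<i> * of_real \<tau>) (2 * sqrt x)) =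
      Gamma (of_real c + \<i> * of_real \<tau> / 2) * Gamma (of_real c - \<i> * of_real \<tau> / 2) / 2"
proof -
  let ?H = "\<lambda>x. of_real (x powr (c - 1)) * Macdonald_K (\<i> * of_real \<tau>) (2 * sqrt x)"
  note G = Gamma_product_shifted[OF assms, of \<tau>]
  have H: "of_real (exp t) * ?H (exp t) = (\<integral>u. of_real (exp (c * t)) *
      (of_real (exp (- 2 * exp (t / 2) * cosh u)) * exp (\<i> * of_real (\<tau> * u))) \<partial>lborel) / 2" for t
  proof -
    have "exp t * exp t powr (c - 1) = exp (c * t)"
      by (simp add: powr_def algebra_simps flip: exp_add)
    moreover have "sqrt (exp t) = exp (t / 2)"
      by (rule real_sqrt_unique) (simp_all add: power2_eq_square flip: exp_add)
    ultimately have "of_real (exp t) * ?H (exp t) = of_real (exp (c * t)) * Macdonald_K (\<i> * of_real \<tau>) (2 * exp (t / 2))"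
      by (simp flip: mult.assoc of_real_mult)
    then show ?thesis
      using Macdonald_K_full_line[of "2 * exp (t / 2)" \<tau>]
      by (simp flip: exp_of_real)
  qed
  have int: "integrable lborel (\<lambda>t. of_real (exp t) * ?H (exp t))"
    unfolding H using lborel_pair.integrable_fst'[OF G(1)] by (auto intro: integrable_divide)
  show *: "set_integrable lborel {0<..} ?H"
    using int integral_exp_substitution(1)[of ?H] by simp
  show "(LBINT x:{0<..}. ?H x) =
      Gamma (of_real c + \<i> * of_real \<tau> / 2) * Gamma (of_real c - \<i> * of_real \<tau> / 2) / 2"
    using integral_exp_substitution(2)[OF _ *] lborel_pair.integral_fst'[OF G(1)] G(2)
    unfolding H by simp
qed

section \<open>Linear maps given on monomials\<close>

definition monomial_map :: "(nat \<Rightarrow> 'a::comm_ring_1 poly) \<Rightarrow> 'a poly \<Rightarrow> 'a poly" where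
  "monomial_map b p = (\<Sum>k\<le>degree p. smult (coeff p k) (b k))"

lemma monomial_map_altdef:
  assumes "degree p \<le> N"
  shows "monomial_map b p = (\<Sum>k\<le>N. smult (coeff p k) (b k))"
  unfolding monomial_map_def
  by (rule sum.mono_neutral_left) (use assms in \<open>auto simp: coeff_eq_0\<close>)

lemma monomial_map_0 [simp]: "monomial_map b 0 = 0"
  by (simp add: monomial_map_def)

lemma monomial_map_add: "monomial_map b (p + q) = monomial_map b p + monomial_map b q"
proof -
  define N where "N = max (degree p) (degree q)"
  have "degree p \<le> N" "degree q \<le> N" "degree (p + q) \<le> N"
    by (auto simp: N_def degree_add_le)
  then show ?thesis
    by (simp add: monomial_map_altdef[of _ N] smult_add_left sum.distrib)
qed

lemma smult_sum_right: "smult c (sum f A) = (\<Sum>i\<in>A. smult c (f i))"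
  by (induction A rule: infinite_finite_induct) (simp_all add: smult_add_right)

lemma monomial_map_smult: "monomial_map b (smult c p) = smult c (monomial_map b p)"
  by (subst monomial_map_altdef[of _ "degree p"])
     (simp_all add: monomial_map_def degree_smult_le smult_sum_right)

lemma monomial_map_sum: "monomial_map b (\<Sum>i\<in>A. f i) = (\<Sum>i\<in>A. monomial_map b (f i))"
  by (induction A rule: infinite_finite_induct) (simp_all add: monomial_map_add)

lemma monomial_map_monom: "monomial_map b (monom a k) = smult a (b k)"
proof -
  have "monomial_map b (monom a k) = (\<Sum>i\<le>k. if i = k then smult a (b k) else 0)"
    unfolding monomial_map_altdef[OF degree_monom_le] by (rule sum.cong) auto
  then show ?thesis by simp
qed

text \<open>The codomain is an arbitrary abelian group, so that the lemma covers both identities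
  between polynomials and identities between their values at a point.\<close>

lemma additive_eq_on_monoms:
  fixes F G :: "'a::comm_ring_1 poly \<Rightarrow> 'b::ab_group_add"
  assumes F: "\<And>p q. F (p + q) = F p + F q" and G: "\<And>p q. G (p + q) = G p + G q"
    and eq: "\<And>a k. F (monom a k) = G (monom a k)"
  shows "F p = G p"
proof -
  have zero: "F 0 = 0" "G 0 = 0"
    using F[of 0 0] G[of 0 0] by simp_all
  have "F (\<Sum>i\<in>A. monom (c i) i) = G (\<Sum>i\<in>A. monom (c i) i)" for A c
    by (induction A rule: infinite_finite_induct) (simp_all add: zero F G eq)
  then show ?thesis
    using poly_as_sum_of_monoms[of p] by metis
qed

text \<open>The map is unitriangular with respect to degree: only the top monomial reaches the top
  degree, and its image is monic.\<close>

lemma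
  fixes b :: "nat \<Rightarrow> 'a::idom poly"
  assumes "\<And>k. degree (b k) = k" "\<And>k. lead_coeff (b k) = 1"
  shows degree_monomial_map: "degree (monomial_map b p) = degree p"
    and lead_coeff_monomial_map: "lead_coeff (monomial_map b p) = lead_coeff p"
proof -
  have le: "degree (monomial_map b p) \<le> degree p"
    unfolding monomial_map_def
    by (rule degree_sum_le) (auto intro: order_trans[OF degree_smult_le] simp: assms)
  have "coeff (monomial_map b p) (degree p) = (\<Sum>k\<le>degree p. if k = degree p then lead_coeff p else 0)"
    unfolding monomial_map_def coeff_sum coeff_smult
  proof (rule sum.cong[OF refl])
    fix k assume "k \<in> {..degree p}"
    then show "coeff p k * coeff (b k) (degree p) = (if k = degree p then lead_coeff p else 0)"
      using assms(1)[of k] assms(2)[of k] by (auto simp: coeff_eq_0)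
  qed
  then have *: "coeff (monomial_map b p) (degree p) = lead_coeff p"
    by simp
  show "degree (monomial_map b p) = degree p"
  proof (cases "p = 0")
    case False
    then have "coeff (monomial_map b p) (degree p) \<noteq> 0" using * by simp
    then show ?thesis by (rule antisym[OF le le_degree])
  qed simp
  with * show "lead_coeff (monomial_map b p) = lead_coeff p" by simp
qed

section \<open>Dual functionals and multiple orthogonality\<close>

text \<open>The moments w(x^n) of the k-th functional w of the dual basis, obtained by forward
  substitution from w(P n) = (1 if n = k, else 0), a triangular system whose diagonal consists of
  the leading coefficients.\<close>

fun dual_moment :: "(nat \<Rightarrow> complex poly) \<Rightarrow> nat \<Rightarrow> nat \<Rightarrow> complex" where
  "dual_moment P k n =
    ((if n = k then 1 else 0) - (\<Sum>i<n. coeff (P n) i * dual_moment P k i)) / coeff (P n) n"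

declare dual_moment.simps [simp del]

lemma dual_functional_exists:
  fixes P :: "nat \<Rightarrow> complex poly"
  assumes P: "\<And>n. P n \<noteq> 0" "\<And>n. degree (P n) = n"
  obtains w where "Vector_Spaces.linear smult (*) w" "\<And>n. w (P n) = (if n = k then 1 else 0)"
proof
  \<comment> \<open>Encoding the moments as constant polynomials makes \<open>monomial_map\<close>
    supply the linear extension; evaluation at 0 reads off the constant.\<close>
  define w where "w p = poly (monomial_map (\<lambda>i. [:dual_moment P k i:]) p) 0" for p
  show "Vector_Spaces.linear smult (*) w"
    unfolding Vector_Spaces.linear_iff w_def
    by (auto simp: monomial_map_add monomial_map_smult vector_space_def
        smult_add_right smult_add_left algebra_simps)
  fix n
  have lc: "coeff (P n) n \<noteq> 0"
    using P[of n] by (metis leading_coeff_0_iff)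
  have "w (P n) = (\<Sum>i\<le>n. coeff (P n) i * dual_moment P k i)"
    by (simp add: w_def monomial_map_def P poly_sum)
  also have "\<dots> = (\<Sum>i<n. coeff (P n) i * dual_moment P k i) + coeff (P n) n * dual_moment P k n"
    by (simp flip: lessThan_Suc_atMost)
  also have "\<dots> = (if n = k then 1 else 0)"
    using lc by (subst dual_moment.simps[of P k n]) (simp add: field_simps)
  finally show "w (P n) = (if n = k then 1 else 0)" .
qed

lemma
  assumes "Vector_Spaces.linear smult (*) (w :: complex poly \<Rightarrow> complex)"
  shows functional_add: "w (p + q) = w p + w q"
    and functional_diff: "w (p - q) = w p - w q"
    and functional_smult: "w (smult c p) = c * w p"
    and functional_sum: "w (\<Sum>i\<in>A. f i) = (\<Sum>i\<in>A. w (f i))"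
proof -
  interpret Vector_Spaces.linear smult "(*)" w by fact
  show "w (p + q) = w p + w q" "w (p - q) = w p - w q" "w (smult c p) = c * w p"
    "w (\<Sum>i\<in>A. f i) = (\<Sum>i\<in>A. w (f i))"
    by (fact add diff scale sum)+
qed

text \<open>The functionals are the first m members of the dual basis of P. Each factor x lowers the
  index by at most m, and a nonzero last coefficient makes this bound sharp. For n + 1 \<ge> m no
  index \<open>n - \<nu>\<close> with \<nu> < m is truncated.\<close>

lemma m_orthogonal_if_recurrence:
  fixes P :: "nat \<Rightarrow> complex poly"
  assumes m: "m \<ge> 1" and P: "\<And>n. P n \<noteq> 0" "\<And>n. degree (P n) = n"
    and rec: "\<And>n. n + 1 \<ge> m \<Longrightarrow>
      P (n + 2) = [:- b n, 1:] * P (n + 1) - (\<Sum>\<nu><m. smult (c n \<nu>) (P (n - \<nu>)))"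
    and nz: "\<And>n. n + 1 \<ge> m \<Longrightarrow> c n (m - 1) \<noteq> 0"
  shows "m_orthogonal m P"
proof -
  have "\<forall>k. \<exists>w. Vector_Spaces.linear smult (*) w \<and> (\<forall>n. w (P n) = (if n = k then 1 else 0))"
    using dual_functional_exists[of P, OF P] by metis
  then obtain w where lin: "Vector_Spaces.linear smult (*) (w k)"
    and dual: "w k (P n) = (if n = k then 1 else 0)" for k n
    by metis
  \<comment> \<open>Vanishing and nonvanishing go through one induction on j: both rest on the same
    reduction from index n to index n - m.\<close>
  have main: "(n > j * m + k \<longrightarrow> w k (monom 1 j * P n) = 0) \<and>
      (n = j * m + k \<longrightarrow> w k (monom 1 j * P n) \<noteq> 0)" for j k n
  proof (induction j arbitrary: n)
    case 0
    then show ?case by (simp add: dual monom_0 flip: one_pCons)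
  next
    case (Suc j)
    show ?case
    proof (cases "n \<ge> Suc j * m + k")
      case True
      with m obtain n' where n: "n = Suc n'" by (cases n) auto
      have ge: "n' + 1 \<ge> m + (j * m + k)" using True n by simp
      let ?v = "\<lambda>i. w k (monom 1 j * P i)"
      have "monom 1 (Suc j) * P n = monom 1 j * ([:0, 1:] * P (n' + 1))"
        by (simp add: n monom_Suc)
      also have "[:0, 1:] * P (n' + 1) =
          P (n' + 2) + smult (b n') (P (n' + 1)) + (\<Sum>\<nu><m. smult (c n' \<nu>) (P (n' - \<nu>)))"
        using rec[of n'] ge by (simp add: algebra_simps)
      also have "w k (monom 1 j * \<dots>) = ?v (n' + 2) + b n' * ?v (n' + 1) + (\<Sum>\<nu><m. c n' \<nu> * ?v (n' - \<nu>))"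
        by (simp add: distrib_left sum_distrib_left functional_add[OF lin] functional_smult[OF lin]
            functional_sum[OF lin])
      also have "?v (n' + 2) = 0"
        using Suc.IH[of "n' + 2"] ge by simp
      also have "?v (n' + 1) = 0"
        using Suc.IH[of "n' + 1"] ge m by simp
      \<comment> \<open>For \<nu> < m - 1 the index n' - \<nu> lies strictly above j m + k, where
        the induction hypothesis gives 0; only the lowest term can reach j m + k.\<close>
      also have "(\<Sum>\<nu><m. c n' \<nu> * ?v (n' - \<nu>)) =
          (\<Sum>\<nu><m. if \<nu> = m - 1 then c n' (m - 1) * ?v (n' - (m - 1)) else 0)"
      proof (rule sum.cong[OF refl])
        fix \<nu> assume "\<nu> \<in> {..<m}"
        then show "c n' \<nu> * ?v (n' - \<nu>) = (if \<nu> = m - 1 then c n' (m - 1) * ?v (n' - (m - 1)) else 0)"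
          using Suc.IH[of "n' - \<nu>"] ge by auto
      qed
      also have "\<dots> = c n' (m - 1) * ?v (n' - (m - 1))"
        using m by simp
      finally have eq: "w k (monom 1 (Suc j) * P n) = c n' (m - 1) * ?v (n' - (m - 1))"
        by simp
      show ?thesis
        unfolding eq using Suc.IH[of "n' - (m - 1)"] nz[of n'] ge m n by auto
    qed auto
  qed
  show ?thesis
    unfolding m_orthogonal_def
    using m P lin main by (intro conjI exI[of _ w]) (auto simp: Suc_le_eq)
qed

section \<open>The transform as a map on polynomials\<close>

definition kl_basis :: "complex \<Rightarrow> nat \<Rightarrow> complex poly" where
  "kl_basis c k = (\<Prod>j<k. [:(c + 1 + of_nat j)\<^sup>2, 1:])"

definition kl_map :: "complex \<Rightarrow> complex poly \<Rightarrow> complex poly" where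
  "kl_map c = monomial_map (kl_basis c)"

lemmas kl_map_add = monomial_map_add[of "kl_basis c" for c, folded kl_map_def]
  and kl_map_smult = monomial_map_smult[of "kl_basis c" for c, folded kl_map_def]
  and kl_map_sum = monomial_map_sum[of "kl_basis c" for c, folded kl_map_def]
  and kl_map_monom = monomial_map_monom[of "kl_basis c" for c, folded kl_map_def]

lemma kl_basis_Suc: "kl_basis c (Suc k) = [:(c + 1 + of_nat k)\<^sup>2, 1:] * kl_basis c k"
  by (simp add: kl_basis_def)

lemma poly_kl_basis:
  "poly (kl_basis c k) (\<tau>\<^sup>2 / 4) =
    pochhammer (c + 1 - \<i> * \<tau> / 2) k * pochhammer (c + 1 + \<i> * \<tau> / 2) k"
proof (induction k)
  case (Suc k)
  have "(c + 1 + of_nat k)\<^sup>2 + \<tau>\<^sup>2 / 4 =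
      (c + 1 - \<i> * \<tau> / 2 + of_nat k) * (c + 1 + \<i> * \<tau> / 2 + of_nat k)"
    by (simp add: power2_eq_square field_simps)
  then have "poly (kl_basis c (Suc k)) (\<tau>\<^sup>2 / 4) =
      ((c + 1 - \<i> * \<tau> / 2 + of_nat k) * (c + 1 + \<i> * \<tau> / 2 + of_nat k)) *
      (pochhammer (c + 1 - \<i> * \<tau> / 2) k * pochhammer (c + 1 + \<i> * \<tau> / 2) k)"
    unfolding kl_basis_Suc poly_mult Suc by simp
  then show ?case
    unfolding pochhammer_Suc by (simp only: mult_ac)
qed (simp add: kl_basis_def)

lemma
  shows degree_kl_basis: "degree (kl_basis c k) = k"
    and lead_coeff_kl_basis: "lead_coeff (kl_basis c k) = 1"
proof -
  have "kl_basis c k \<noteq> 0 \<and> degree (kl_basis c k) = k \<and> lead_coeff (kl_basis c k) = 1"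
  proof (induction k)
    case (Suc k)
    then have "degree (kl_basis c (Suc k)) = Suc k"
      unfolding kl_basis_Suc by (subst degree_mult_eq) auto
    moreover have "lead_coeff (kl_basis c (Suc k)) = 1"
      using Suc unfolding kl_basis_Suc lead_coeff_mult by auto
    ultimately show ?case by auto
  qed (simp add: kl_basis_def)
  then show "degree (kl_basis c k) = k" "lead_coeff (kl_basis c k) = 1"
    by auto
qed

lemmas degree_kl_map =
    degree_monomial_map[of "kl_basis c" for c, OF degree_kl_basis lead_coeff_kl_basis, folded kl_map_def]
  and lead_coeff_kl_map =
    lead_coeff_monomial_map[of "kl_basis c" for c, OF degree_kl_basis lead_coeff_kl_basis, folded kl_map_def]

section \<open>The Euler operator; multiplication by z and central differences under the
  transform\<close>

definition shifted_euler :: "complex \<Rightarrow> complex poly \<Rightarrow> complex poly" where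
  "shifted_euler c p = smult (c + 1) p + [:0, 1:] * pderiv p"

lemma shifted_euler_add: "shifted_euler c (p + q) = shifted_euler c p + shifted_euler c q"
  by (simp add: shifted_euler_def pderiv_add algebra_simps smult_add_right)

lemma shifted_euler_smult: "shifted_euler c (smult a p) = smult a (shifted_euler c p)"
  by (simp add: shifted_euler_def pderiv_smult smult_add_right mult.commute)

lemma shifted_euler_monom: "shifted_euler c (monom a k) = monom ((c + 1 + of_nat k) * a) k"
  by (cases k) (simp_all add: shifted_euler_def pderiv_monom smult_monom add_monom monom_Suc[symmetric] algebra_simps)

text \<open>On monomials this is the recursion of \<open>kl_basis\<close>: its factor (c + 1 + k)^2
  is the eigenvalue of the squared shifted Euler operator on x^k.\<close>

lemma mult_kl_map:
  "[:0, 1:] * kl_map c p = kl_map c ([:0, 1:] * p) - kl_map c (shifted_euler c (shifted_euler c p))"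
proof (rule additive_eq_on_monoms[of _ _ p])
  fix a k
  have "[:0, 1:] * kl_map c (monom a k) = smult a ([:0, 1:] * kl_basis c k)"
    by (simp add: kl_map_monom)
  also have "[:0, 1:] * kl_basis c k = kl_basis c (Suc k) - smult ((c + 1 + of_nat k)\<^sup>2) (kl_basis c k)"
    by (simp add: kl_basis_Suc)
  finally show "[:0, 1:] * kl_map c (monom a k) =
      kl_map c ([:0, 1:] * monom a k) - kl_map c (shifted_euler c (shifted_euler c (monom a k)))"
    by (simp add: shifted_euler_monom kl_map_monom monom_Suc[symmetric] smult_diff_right power2_eq_square mult_ac)
qed (simp_all only: kl_map_add shifted_euler_add distrib_left, simp_all)

text \<open>On monomials both shifted values contain (u+1)_j (v+1)_j. What remains of their
  difference is (j+1)(v - u) = (j+1) i \<tau>, which the denominator 2 i \<tau> turns into half the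
  factor of the derivative.\<close>

lemma central_diff_kl_map:
  assumes "\<tau> \<noteq> 0"
  shows "central_diff \<i> (\<lambda>t. poly (kl_map c p) (t\<^sup>2 / 4)) \<tau> =
    poly (kl_map (c + 1 / 2) (pderiv p)) (\<tau>\<^sup>2 / 4) / 2"
proof (rule additive_eq_on_monoms[of _ _ p])
  fix a k
  show "central_diff \<i> (\<lambda>t. poly (kl_map c (monom a k)) (t\<^sup>2 / 4)) \<tau> =
    poly (kl_map (c + 1 / 2) (pderiv (monom a k))) (\<tau>\<^sup>2 / 4) / 2"
  proof (cases k)
    case 0
    then show ?thesis
      by (simp add: central_diff_def kl_map_monom kl_basis_def pderiv_monom)
        (simp add: kl_map_def)
  next
    case (Suc j)
    \<comment> \<open>Centred so that \<tau> + i raises only the first of the two Pochhammer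
      arguments by 1, and \<tau> - i only the second.\<close>
    define u v where "u = c + 1 / 2 - \<i> * \<tau> / 2" and "v = c + 1 / 2 + \<i> * \<tau> / 2"
    have plus: "c + 1 - \<i> * (\<tau> + \<i>) / 2 = u + 1" "c + 1 + \<i> * (\<tau> + \<i>) / 2 = v"
      and minus: "c + 1 - \<i> * (\<tau> - \<i>) / 2 = u" "c + 1 + \<i> * (\<tau> - \<i>) / 2 = v + 1"
      and mid: "c + 1 / 2 + 1 - \<i> * \<tau> / 2 = u + 1" "c + 1 / 2 + 1 + \<i> * \<tau> / 2 = v + 1"
      by (simp_all add: u_def v_def field_simps)
    have uv: "v - u = \<i> * \<tau>" by (simp add: u_def v_def)
    have "pochhammer (u + 1) (Suc j) * pochhammer v (Suc j) - pochhammer u (Suc j) * pochhammer (v + 1) (Suc j) =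
        pochhammer (u + 1) j * pochhammer (v + 1) j * ((u + 1 + of_nat j) * v - u * (v + 1 + of_nat j))"
      unfolding pochhammer_Suc[of "u + 1"] pochhammer_Suc[of "v + 1"] pochhammer_rec[of u] pochhammer_rec[of v]
      by (simp add: algebra_simps)
    also have "(u + 1 + of_nat j) * v - u * (v + 1 + of_nat j) = of_nat (Suc j) * (\<i> * \<tau>)"
      unfolding uv[symmetric] by (simp add: algebra_simps)
    finally have key: "pochhammer (u + 1) (Suc j) * pochhammer v (Suc j) - pochhammer u (Suc j) * pochhammer (v + 1) (Suc j) =
        pochhammer (u + 1) j * pochhammer (v + 1) j * (of_nat (Suc j) * (\<i> * \<tau>))" .
    have "central_diff \<i> (\<lambda>t. poly (kl_map c (monom a k)) (t\<^sup>2 / 4)) \<tau> =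
        a * (pochhammer (u + 1) (Suc j) * pochhammer v (Suc j) - pochhammer u (Suc j) * pochhammer (v + 1) (Suc j))
          / (2 * \<i> * \<tau>)"
      unfolding central_diff_def kl_map_monom poly_smult poly_kl_basis plus minus Suc
      by (simp only: right_diff_distrib)
    also have "\<dots> = of_nat (Suc j) * a * (pochhammer (u + 1) j * pochhammer (v + 1) j) / 2"
      unfolding key using assms by (simp del: of_nat_Suc)
    also have "\<dots> = poly (kl_map (c + 1 / 2) (pderiv (monom a k))) (\<tau>\<^sup>2 / 4) / 2"
      unfolding Suc pderiv_monom kl_map_monom poly_smult poly_kl_basis mid by simp
    finally show ?thesis .
  qed
qed (simp_all add: central_diff_def kl_map_add pderiv_add add_divide_distrib diff_divide_distrib ring_distribs)

section \<open>The Kontorovich-Lebedev transform of a polynomial\<close>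

text \<open>This is the Mellin transform at exponent \<alpha> + 1 + k. The normalising factor |Gamma
  z|^2 is Gamma z times Gamma (cnj z), so the Gamma quotients become Pochhammer symbols; \<alpha>
  \<ge> 0 keeps z and its conjugate off the poles.\<close>

lemma KL_monomials:
  assumes "\<alpha> \<ge> 0"
  shows "set_integrable lborel {0<..} (\<lambda>x. of_real (x powr \<alpha>) *
      Macdonald_K (\<i> * of_real \<tau>) (2 * sqrt x) * of_real x ^ k)"
    and "KL \<alpha> (\<lambda>x. of_real x ^ k) \<tau> = poly (kl_basis (of_real \<alpha>) k) (of_real (\<tau>\<^sup>2 / 4))"
proof -
  define c where "c = \<alpha> + 1 + real k"
  have c: "c > 0" using assms by (simp add: c_def)
  let ?K = "\<lambda>x. Macdonald_K (\<i> * of_real \<tau>) (2 * sqrt x)"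
  have eq: "of_real (x powr \<alpha>) * ?K x * of_real x ^ k = of_real (x powr (c - 1)) * ?K x"
    if "x \<in> {0<..}" for x
  proof -
    have "x powr (c - 1) = x powr \<alpha> * x ^ k"
      using that by (simp add: c_def powr_add powr_realpow)
    then show ?thesis by simp
  qed
  show "set_integrable lborel {0<..} (\<lambda>x. of_real (x powr \<alpha>) * ?K x * of_real x ^ k)"
    using Macdonald_K_Mellin(1)[OF c, of \<tau>] by (subst set_integrable_cong[OF refl refl eq])
  define z where "z = of_real \<alpha> + 1 + \<i> * of_real \<tau> / 2"
  have cnj_z: "cnj z = of_real \<alpha> + 1 - \<i> * of_real \<tau> / 2"
    by (simp add: z_def)
  have pos: "Re z > 0" "Re (cnj z) > 0" using assms by (simp_all add: z_def)
  have not_pole: "z \<notin> \<int>\<^sub>\<le>\<^sub>0" "cnj z \<notin> \<int>\<^sub>\<le>\<^sub>0"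
    using pos by (metis nonpos_Ints_cases complex_Re_of_int of_int_0_less_iff not_le)+
  have Gamma_shift: "Gamma (z + of_nat k) = pochhammer z k * Gamma z"
    "Gamma (cnj z + of_nat k) = pochhammer (cnj z) k * Gamma (cnj z)"
    using not_pole by (simp_all add: pochhammer_Gamma Gamma_eq_zero_iff)
  have norm: "of_real ((cmod (Gamma z))\<^sup>2) = Gamma z * Gamma (cnj z)"
    unfolding complex_norm_square cnj_Gamma ..
  have "(LBINT x:{0<..}. of_real (x powr \<alpha>) * ?K x * of_real x ^ k) =
      (LBINT x:{0<..}. of_real (x powr (c - 1)) * ?K x)"
    by (rule set_lebesgue_integral_cong) (auto simp: eq)
  also have "\<dots> = Gamma (z + of_nat k) * Gamma (cnj z + of_nat k) / 2"
    unfolding Macdonald_K_Mellin(2)[OF c] by (simp add: z_def c_def algebra_simps)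
  finally have Mellin: "(LBINT x:{0<..}. of_real (x powr \<alpha>) * ?K x * of_real x ^ k) =
      Gamma (z + of_nat k) * Gamma (cnj z + of_nat k) / 2" .
  have "KL \<alpha> (\<lambda>x. of_real x ^ k) \<tau> = 2 * inverse (of_real ((cmod (Gamma z))\<^sup>2)) *
      (LBINT x:{0<..}. of_real (x powr \<alpha>) * ?K x * of_real x ^ k)"
    by (simp only: KL_def z_def of_real_inverse)
  also have "\<dots> = 2 * inverse (Gamma z * Gamma (cnj z)) * (Gamma (z + of_nat k) * Gamma (cnj z + of_nat k) / 2)"
    unfolding norm Mellin ..
  also have "\<dots> = pochhammer (cnj z) k * pochhammer z k"
  proof -
    have "Gamma z \<noteq> 0" "Gamma (cnj z) \<noteq> 0"
      using not_pole by (simp_all add: Gamma_eq_zero_iff)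
    then show ?thesis
      unfolding Gamma_shift by (simp add: field_simps)
  qed
  also have "\<dots> = poly (kl_basis (of_real \<alpha>) k) ((of_real \<tau>)\<^sup>2 / 4)"
    unfolding poly_kl_basis cnj_z by (simp add: z_def)
  finally show "KL \<alpha> (\<lambda>x. of_real x ^ k) \<tau> = poly (kl_basis (of_real \<alpha>) k) (of_real (\<tau>\<^sup>2 / 4))"
    by simp
qed

lemma KL_poly_values:
  assumes "\<alpha> \<ge> 0"
  shows "KL \<alpha> (\<lambda>x. poly f (of_real x)) \<tau> = poly (kl_map (of_real \<alpha>) f) (of_real (\<tau>\<^sup>2 / 4))"
proof -
  let ?g = "\<lambda>k x. of_real (x powr \<alpha>) * Macdonald_K (\<i> * of_real \<tau>) (2 * sqrt x) * of_real x ^ k"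
  let ?c = "2 * of_real (inverse ((cmod (Gamma (of_real \<alpha> + 1 + \<i> * of_real \<tau> / 2)))\<^sup>2)) :: complex"
  have "of_real (x powr \<alpha>) * Macdonald_K (\<i> * of_real \<tau>) (2 * sqrt x) * poly f (of_real x) =
      (\<Sum>k\<le>degree f. coeff f k * ?g k x)" for x
    by (simp add: poly_altdef sum_distrib_left mult_ac)
  then have "KL \<alpha> (\<lambda>x. poly f (of_real x)) \<tau> = ?c * (LBINT x:{0<..}. (\<Sum>k\<le>degree f. coeff f k * ?g k x))"
    by (simp add: KL_def)
  also have "(LBINT x:{0<..}. (\<Sum>k\<le>degree f. coeff f k * ?g k x)) =
      (\<Sum>k\<le>degree f. coeff f k * (LBINT x:{0<..}. ?g k x))"
    using set_integrable_mult_right[OF KL_monomials(1)[OF assms, of \<tau>]]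
    unfolding set_integral_mult_right[symmetric]
    unfolding set_lebesgue_integral_def set_integrable_def scaleR_sum_right
    by (subst Bochner_Integration.integral_sum) simp_all
  also have "?c * \<dots> = (\<Sum>k\<le>degree f. coeff f k * KL \<alpha> (\<lambda>x. of_real x ^ k) \<tau>)"
    by (simp add: KL_def sum_distrib_left mult_ac)
  also have "\<dots> = poly (kl_map (of_real \<alpha>) f) (of_real (\<tau>\<^sup>2 / 4))"
    by (simp add: KL_monomials(2)[OF assms] kl_map_def monomial_map_def poly_sum)
  finally show ?thesis .
qed

text \<open>The uniqueness half of the definite description in \<open>KL_poly\<close>: \<tau>^2/4
  runs through all positive reals, too many for the roots of a nonzero difference.\<close>

lemma poly_eqI_at_squares:
  fixes p q :: "complex poly"
  assumes "\<And>\<tau>::real. \<tau> > 0 \<Longrightarrow> poly p (of_real (\<tau>\<^sup>2 / 4)) = poly q (of_real (\<tau>\<^sup>2 / 4))"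
  shows "p = q"
proof (rule ccontr)
  assume "p \<noteq> q"
  then have "finite {x. poly (p - q) x = 0}"
    by (intro poly_roots_finite) auto
  moreover have "(\<lambda>s. of_real s) ` {0<..} \<subseteq> {x::complex. poly (p - q) x = 0}"
  proof (intro image_subsetI CollectI)
    fix s :: real assume "s \<in> {0<..}"
    then show "poly (p - q) (of_real s) = 0"
      using assms[of "2 * sqrt s"] by (simp add: power_mult_distrib)
  qed
  ultimately have "finite ((\<lambda>s. of_real s :: complex) ` {0::real<..})"
    by (rule rev_finite_subset)
  then show False
    by (subst (asm) finite_image_iff) (auto simp: inj_on_def infinite_Ioi)
qed

lemma KL_poly_eq_kl_map:
  assumes "\<alpha> \<ge> 0"
  shows "KL_poly \<alpha> f = kl_map (of_real \<alpha>) f"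
  unfolding KL_poly_def
  by (rule the_equality) (auto simp: KL_poly_values[OF assms] intro: poly_eqI_at_squares)

section \<open>Coefficients of the reversed Appell sequence\<close>

definition denom_poch :: "complex list \<Rightarrow> nat \<Rightarrow> complex" where
  "denom_poch as k = (\<Prod>a\<leftarrow>as. pochhammer (a + 1) k)"

lemma denom_poch_Suc: "denom_poch as (Suc k) = denom_poch as k * (\<Prod>a\<leftarrow>as. of_nat k + 1 + a)"
  by (induction as) (simp_all add: denom_poch_def pochhammer_Suc algebra_simps)

lemma denom_poch_Suc_shift:
  "denom_poch as (Suc k) = (\<Prod>a\<leftarrow>as. a + 1) * denom_poch (map (\<lambda>a. a + 1) as) k"
  by (induction as) (simp_all add: denom_poch_def pochhammer_rec algebra_simps)

lemma denom_poch_neq_0: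
  assumes "\<forall>a\<in>set as. \<forall>k::nat. k \<ge> 1 \<longrightarrow> - a \<noteq> of_nat k"
  shows "denom_poch as k \<noteq> 0"
proof -
  have "pochhammer (a + 1) k \<noteq> 0" if "a \<in> set as" for a
  proof
    assume "pochhammer (a + 1) k = 0"
    then obtain j where "a + 1 = - of_nat j" by (auto simp: pochhammer_eq_0_iff)
    then have "- a = of_nat (Suc j)" by (simp add: eq_neg_iff_add_eq_0 neg_eq_iff_add_eq_0 add_ac)
    then show False using assms that by (metis Suc_le_mono le0 One_nat_def)
  qed
  then show ?thesis by (auto simp: denom_poch_def prod_list_zero_iff)
qed

text \<open>\<open>fps_hypergeo\<close> builds its denominators by a left fold; this turns them into
  the products used here.\<close>

lemma foldl_pochhammer:
  "foldl (\<lambda>r b. r * pochhammer b k) x (map (\<lambda>a. a + 1) as) = x * denom_poch as k"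
  by (induction as arbitrary: x) (simp_all add: denom_poch_def)

lemma inverse_lam: "1 / lam as n = (- 1) ^ n * denom_poch as n"
  by (cases "even n") (simp_all add: lam_def denom_poch_def divide_inverse)

lemma coeff_R:
  "coeff (R as n) k = (- 1) ^ n * denom_poch as n * pochhammer (- of_nat n) k / (denom_poch as k * fact k)"
proof -
  have "coeff (R as n) k = 1 / lam as n *
      (\<Sum>i\<le>n. if i = k then pochhammer (- of_nat n) i / (denom_poch as i * fact i) else 0)"
    by (simp add: R_def coeff_sum foldl_pochhammer)
  also have "(\<Sum>i\<le>n. if i = k then pochhammer (- of_nat n) i / (denom_poch as i * fact i) else 0) =
      pochhammer (- of_nat n) k / (denom_poch as k * fact k)"
    by (simp add: pochhammer_of_nat_eq_0_lemma)
  finally show ?thesis by (simp add: inverse_lam)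
qed

lemma
  assumes "\<forall>a\<in>set as. \<forall>k::nat. k \<ge> 1 \<longrightarrow> - a \<noteq> of_nat k"
  shows degree_R: "degree (R as n) = n" and lead_coeff_R: "lead_coeff (R as n) = 1"
proof -
  have 1: "coeff (R as n) n = 1"
    using denom_poch_neq_0[OF assms, of n] by (simp add: coeff_R pochhammer_same flip: power_mult_distrib)
  have "degree (R as n) \<le> n"
    by (rule degree_le) (simp add: coeff_R pochhammer_of_nat_eq_0_lemma)
  with 1 show "degree (R as n) = n" by (intro antisym le_degree) auto
  with 1 show "lead_coeff (R as n) = 1" by simp
qed

text \<open>From (-n-1)_k (n+1-k) = (n+1) (-n)_k the coefficient of x^k in R (n+1), multiplied by
  n+1-k, is a constant times that in R n. Writing k = (n+1) - (n+1-k) splits the Euler operator into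
  a diagonal part and a lowering part.\<close>

lemma shifted_euler_R:
  "shifted_euler c (R as (Suc n)) = smult (of_nat n + 2 + c) (R as (Suc n)) +
     smult ((of_nat n + 1) * (\<Prod>a\<leftarrow>as. of_nat n + 1 + a)) (R as n)"
proof (rule poly_eqI)
  fix k
  have "pochhammer (- of_nat (Suc n) :: complex) k * (- of_nat (Suc n) + of_nat k) =
    - of_nat (Suc n) * pochhammer (- of_nat (Suc n) + 1) k"
    by (simp only: pochhammer_rec[symmetric] pochhammer_Suc[symmetric])
  moreover have "- of_nat (Suc n) + 1 = (- of_nat n :: complex)"
    by simp
  moreover have "X * (N - K) = N * Y" if "X * (- N + K) = - N * Y" for X Y N K :: complex
    using that by (simp add: algebra_simps)
  ultimately have 1: "pochhammer (- of_nat (Suc n) :: complex) k * (of_nat (Suc n) - of_nat k) =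
    of_nat (Suc n) * pochhammer (- of_nat n) k"
    by metis
  have "coeff (shifted_euler c (R as (Suc n))) k = (c + 1 + of_nat k) * coeff (R as (Suc n)) k"
    by (cases k) (simp_all add: shifted_euler_def coeff_pderiv algebra_simps)
  moreover have "(of_nat (Suc n) - of_nat k) * coeff (R as (Suc n)) k =
      - of_nat (Suc n) * (\<Prod>a\<leftarrow>as. of_nat n + 1 + a) * coeff (R as n) k"
  proof -
    define q where "q = (\<Prod>a\<leftarrow>as. of_nat n + 1 + a)"
    have "(of_nat (Suc n) - of_nat k) * coeff (R as (Suc n)) k = (- 1) ^ Suc n * denom_poch as (Suc n) *
        (pochhammer (- of_nat (Suc n)) k * (of_nat (Suc n) - of_nat k)) / (denom_poch as k * fact k)"
      unfolding coeff_R by simp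
    also have "\<dots> = - of_nat (Suc n) * (\<Prod>a\<leftarrow>as. of_nat n + 1 + a) * coeff (R as n) k"
      unfolding 1 coeff_R denom_poch_Suc q_def[symmetric] by (simp add: mult_ac del: of_nat_Suc)
    finally show ?thesis .
  qed
  ultimately show "coeff (shifted_euler c (R as (Suc n))) k =
      coeff (smult (of_nat n + 2 + c) (R as (Suc n)) +
     smult ((of_nat n + 1) * (\<Prod>a\<leftarrow>as. of_nat n + 1 + a)) (R as n)) k"
    by (simp add: algebra_simps)
qed

text \<open>Differentiation strips the first factor from every Pochhammer symbol; the product of the
  a + 1 lost from the denominators cancels against the one in the normalisation.\<close>

lemma pderiv_R:
  assumes "\<forall>a\<in>set as. \<forall>k::nat. k \<ge> 1 \<longrightarrow> - a \<noteq> of_nat k"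
  shows "pderiv (R as (Suc n)) = smult (of_nat (Suc n)) (R (map (\<lambda>a. a + 1) as) n)"
proof (rule poly_eqI)
  fix k
  define q where "q = (\<Prod>a\<leftarrow>as. a + 1)"
  have "q \<noteq> 0"
    using denom_poch_neq_0[OF assms, of 1] by (simp add: denom_poch_def q_def)
  moreover have "1 - of_nat (Suc n) = (- of_nat n :: complex)"
    by simp
  ultimately show "coeff (pderiv (R as (Suc n))) k = coeff (smult (of_nat (Suc n)) (R (map (\<lambda>a. a + 1) as) n)) k"
    unfolding coeff_pderiv coeff_smult coeff_R denom_poch_Suc_shift q_def[symmetric]
    by (simp add: pochhammer_rec fact_Suc divide_simps del: of_nat_Suc)
qed

text \<open>\<open>T\<^sub>n = \<lambda>\<^sub>n R\<^sub>n\<close> is \<open>\<Sum>\<^sub>k (-1)\<^sup>k (n choose k) y\<^sub>k\<close> with \<open>y\<^sub>k = x\<^sup>k / denom_poch as k\<close>, and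
  \<open>x y\<^sub>k = \<Prod>\<^sub>a (k + 1 + a) y\<^sub>k\<^sub>+\<^sub>1\<close>. The polynomials below insert the factors \<open>k + 1 + a\<close> one at a time.\<close>

definition partial_shift :: "complex list \<Rightarrow> complex list \<Rightarrow> nat \<Rightarrow> complex poly" where
  "partial_shift as bs n = (\<Sum>k\<le>n. monom ((- 1) ^ k * of_nat (n choose k) *
     (\<Prod>b\<leftarrow>bs. of_nat k + 1 + b) / denom_poch as (Suc k)) (Suc k))"

lemma coeff_partial_shift:
  "coeff (partial_shift as bs n) k = (case k of 0 \<Rightarrow> 0 | Suc j \<Rightarrow>
     (- 1) ^ j * of_nat (n choose j) * (\<Prod>b\<leftarrow>bs. of_nat j + 1 + b) / denom_poch as (Suc j))"
proof (cases k)
  case (Suc j)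
  have "coeff (partial_shift as bs n) k = (\<Sum>i\<le>n. if i = j then (- 1) ^ i * of_nat (n choose i) *
     (\<Prod>b\<leftarrow>bs. of_nat i + 1 + b) / denom_poch as (Suc i) else 0)"
    by (simp add: partial_shift_def coeff_sum Suc)
  then show ?thesis by (simp add: Suc)
qed (simp add: partial_shift_def coeff_sum)

lemma coeff_lam_R:
  assumes "\<forall>a\<in>set as. \<forall>k::nat. k \<ge> 1 \<longrightarrow> - a \<noteq> of_nat k"
  shows "coeff (smult (lam as n) (R as n)) k = (- 1) ^ k * of_nat (n choose k) / denom_poch as k"
proof -
  have "lam as n * ((- 1) ^ n * denom_poch as n) = 1"
    using denom_poch_neq_0[OF assms, of n]
    by (cases "even n") (simp_all add: lam_def denom_poch_def)
  then have "coeff (smult (lam as n) (R as n)) k = pochhammer (- of_nat n) k / (denom_poch as k * fact k)"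
    by (simp add: coeff_R)
  then show ?thesis
    by (simp add: binomial_gbinomial gbinomial_pochhammer flip: power_mult_distrib)
qed

text \<open>Pascal's rule: binom(n+1, j+1) - binom(n, j+1) = binom(n, j).\<close>

lemma partial_shift_Nil:
  assumes "\<forall>a\<in>set as. \<forall>k::nat. k \<ge> 1 \<longrightarrow> - a \<noteq> of_nat k"
  shows "partial_shift as [] n = smult (lam as n) (R as n) - smult (lam as (Suc n)) (R as (Suc n))"
proof (rule poly_eqI)
  fix k
  show "coeff (partial_shift as [] n) k =
      coeff (smult (lam as n) (R as n) - smult (lam as (Suc n)) (R as (Suc n))) k"
    unfolding coeff_diff coeff_lam_R[OF assms] coeff_partial_shift
    by (cases k) (simp_all add: add_divide_distrib diff_divide_distrib algebra_simps)
qed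

text \<open>Write j + 1 + b = (n + 1 + b) - (n - j) and absorb n - j into the binomial coefficient.
  Inserting one factor thus costs one lower index. For n = 0 the truncated \<open>n - 1\<close> is
  harmless, its factor being 0.\<close>

lemma partial_shift_Cons:
  "partial_shift as (b # bs) n =
     smult (of_nat n + 1 + b) (partial_shift as bs n) - smult (of_nat n) (partial_shift as bs (n - 1))"
proof (rule poly_eqI)
  fix k
  have *: "of_nat n * of_nat ((n - 1) choose j) = (of_nat n - of_nat j) * (of_nat (n choose j) :: complex)" for j
  proof (cases "j \<le> n")
    case True
    then show ?thesis
      using arg_cong[OF binomial_absorb_comp[of n j], of "of_nat :: nat \<Rightarrow> complex"]
      by (simp add: of_nat_diff)
  qed (simp add: binomial_eq_0)
  have "(of_nat j + 1 + b) * of_nat (n choose j) =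
     (of_nat n + 1 + b) * of_nat (n choose j) - of_nat n * (of_nat ((n - 1) choose j) :: complex)" for j
    unfolding * by (simp add: algebra_simps)
  note ** = this
  show "coeff (partial_shift as (b # bs) n) k = coeff (smult (of_nat n + 1 + b) (partial_shift as bs n)
       - smult (of_nat n) (partial_shift as bs (n - 1))) k"
  proof (cases k)
    case (Suc j)
    define q where "q = (- 1) ^ j * (\<Prod>b\<leftarrow>bs. of_nat j + 1 + b) / denom_poch as (Suc j)"
    have coeff_q: "coeff (partial_shift as bs m) k = of_nat (m choose j) * q" for m
      by (simp add: coeff_partial_shift Suc q_def)
    have "coeff (partial_shift as (b # bs) n) k = ((of_nat j + 1 + b) * of_nat (n choose j)) * q"
      by (simp add: coeff_partial_shift Suc q_def)
    then show ?thesis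
      unfolding ** coeff_diff coeff_smult coeff_q by (simp add: algebra_simps)
  qed (simp add: coeff_partial_shift)
qed

text \<open>Once all parameters are inserted, the product cancels the step from
  \<open>denom_poch as j\<close> to \<open>denom_poch as (Suc j)\<close>. Together with the two
  preceding lemmas this expands x R n in the R m.\<close>

lemma mult_R_eq_partial_shift:
  assumes "\<forall>a\<in>set as. \<forall>k::nat. k \<ge> 1 \<longrightarrow> - a \<noteq> of_nat k"
  shows "[:0, 1:] * R as n = smult (1 / lam as n) (partial_shift as as n)"
proof (rule poly_eqI)
  fix k
  have lam: "lam as n \<noteq> 0"
    using denom_poch_neq_0[OF assms, of n] by (simp add: lam_def denom_poch_def)
  show "coeff ([:0, 1:] * R as n) k = coeff (smult (1 / lam as n) (partial_shift as as n)) k"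
  proof (cases k)
    case (Suc j)
    have "(\<Prod>a\<leftarrow>as. of_nat j + 1 + a) \<noteq> 0"
      using denom_poch_neq_0[OF assms, of "Suc j"] by (auto simp: denom_poch_Suc)
    then have frac: "(\<Prod>b\<leftarrow>as. of_nat j + 1 + b) / denom_poch as (Suc j) = 1 / denom_poch as j"
      by (simp add: denom_poch_Suc)
    have "coeff (partial_shift as as n) k =
        (- 1) ^ j * of_nat (n choose j) * ((\<Prod>b\<leftarrow>as. of_nat j + 1 + b) / denom_poch as (Suc j))"
      by (simp add: coeff_partial_shift Suc)
    also have "\<dots> = lam as n * coeff (R as n) j"
      unfolding frac using coeff_lam_R[OF assms, of n j] by simp
    finally have "coeff (partial_shift as as n) k = lam as n * coeff (R as n) j" .
    then show ?thesis using lam by (simp add: Suc)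
  qed (simp add: coeff_partial_shift)
qed

lemma prod_list_shift_neq_0:
  fixes as :: "complex list"
  assumes "\<forall>a\<in>set as. \<forall>k::nat. k \<ge> 1 \<longrightarrow> - a \<noteq> of_nat k"
  shows "(\<Prod>a\<leftarrow>as. of_nat n + 1 + a) \<noteq> 0"
  using denom_poch_neq_0[OF assms, of "Suc n"] unfolding denom_poch_Suc by auto

lemma
  assumes "\<forall>a\<in>set as. \<forall>k::nat. k \<ge> 1 \<longrightarrow> - a \<noteq> of_nat k"
  shows lam_neq_0: "lam as n \<noteq> 0"
    and lam_eq_lam_Suc: "lam as n = - (\<Prod>a\<leftarrow>as. of_nat n + 1 + a) * lam as (Suc n)"
proof -
  have lam: "lam as n = (- 1) ^ n / denom_poch as n" for n
    by (simp add: lam_def denom_poch_def divide_inverse)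
  show "lam as n \<noteq> 0"
    using denom_poch_neq_0[OF assms, of n] by (simp add: lam)
  show "lam as n = - (\<Prod>a\<leftarrow>as. of_nat n + 1 + a) * lam as (Suc n)"
    using prod_list_shift_neq_0[OF assms, of n] by (simp add: lam denom_poch_Suc)
qed

section \<open>Recurrence coefficients\<close>

context
  fixes as :: "complex list" and w :: "complex poly \<Rightarrow> complex" and j :: nat
  assumes admissible: "\<forall>a\<in>set as. \<forall>k::nat. k \<ge> 1 \<longrightarrow> - a \<noteq> of_nat k"
    and linear: "Vector_Spaces.linear smult (*) w"
    and dual: "\<And>n. w (R as n) = (if n = j then 1 else 0)"
begin

lemma dual_partial_shift_Nil:
  "w (partial_shift as [] n) = (if n = j then lam as j else if Suc n = j then - lam as j else 0)"
  unfolding partial_shift_Nil[OF admissible] functional_diff[OF linear] functional_smult[OF linear] dual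
  by auto

lemma dual_partial_shift_Cons:
  "w (partial_shift as (b # bs) n) =
    (of_nat n + 1 + b) * w (partial_shift as bs n) - of_nat n * w (partial_shift as bs (n - 1))"
  unfolding partial_shift_Cons functional_diff[OF linear] functional_smult[OF linear] ..

text \<open>At n = j + length (b # bs) only the second term of
  \<open>dual_partial_shift_Cons\<close> survives; it carries the factor -n, nonzero since n \<ge>
  1.\<close>

lemma dual_partial_shift_lowest:
  "(\<forall>n > j + length bs. w (partial_shift as bs n) = 0) \<and> w (partial_shift as bs (j + length bs)) \<noteq> 0"
proof (induction bs)
  case Nil
  then show ?case by (simp add: dual_partial_shift_Nil lam_neq_0[OF admissible])
next
  case (Cons b bs)
  then show ?case by (auto simp: dual_partial_shift_Cons simp del: of_nat_Suc)
qed

text \<open>The recurrence coefficients enter as arbitrary given numbers; the functional dual to R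
  j, with j = n - \<nu>, determines them. The terms of index n + 1 and n + 2 lie above j and drop
  out.\<close>

lemma R_recurrence_coeff:
  assumes rec: "[:0, 1:] * R as (n + 1) = R as (n + 2) + smult \<beta> (R as (n + 1)) +
      (\<Sum>\<nu>=0..d-1. if \<nu> \<le> n then smult (g \<nu>) (R as (n - \<nu>)) else 0)"
    and "\<nu> \<le> d - 1" "n = j + \<nu>"
  shows "g \<nu> = w (partial_shift as as (n + 1)) / lam as (n + 1)"
proof -
  have w0: "w 0 = 0" using functional_smult[OF linear, of 0 0] by simp
  have "w ([:0, 1:] * R as (n + 1)) = (\<Sum>\<mu>=0..d-1. w (if \<mu> \<le> n then smult (g \<mu>) (R as (n - \<mu>)) else 0))"
    unfolding rec functional_add[OF linear] functional_sum[OF linear] functional_smult[OF linear]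
    using assms(3) by (simp add: dual)
  also have "\<dots> = (\<Sum>\<mu>=0..d-1. if \<mu> = \<nu> then g \<nu> else 0)"
  proof (rule sum.cong[OF refl])
    fix \<mu>
    show "w (if \<mu> \<le> n then smult (g \<mu>) (R as (n - \<mu>)) else 0) = (if \<mu> = \<nu> then g \<nu> else 0)"
      using assms(3) by (auto simp: functional_smult[OF linear] dual w0)
  qed
  also have "\<dots> = g \<nu>" using assms(2) by simp
  finally show ?thesis
    unfolding mult_R_eq_partial_shift[OF admissible] functional_smult[OF linear] by simp
qed

end

section \<open>Recurrence of the transformed sequence\<close>

lemma shifted_euler_R':
  "shifted_euler c (R as n) = smult (of_nat n + 1 + c) (R as n) +
     (if n = 0 then 0 else smult (of_nat n * (\<Prod>a\<leftarrow>as. of_nat n + a)) (R as (n - 1)))"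
proof (cases n)
  case 0
  have "denom_poch as 0 = 1" by (induction as) (simp_all add: denom_poch_def)
  then have "R as 0 = 1" by (intro poly_eqI) (simp add: coeff_R pochhammer_0_left)
  then show ?thesis by (simp add: 0 shifted_euler_def add.commute)
next
  case (Suc m)
  have "of_nat (Suc m) = of_nat m + (1 :: complex)" "of_nat m + 1 + 1 + c = of_nat m + 2 + c"
    by simp_all
  then show ?thesis
    by (simp only: Suc shifted_euler_R diff_Suc_1 nat.distinct if_False)
qed

lemma prod_list_times: "(\<Prod>a\<leftarrow>as. f a * g a) = (\<Prod>a\<leftarrow>as. f a) * (\<Prod>a\<leftarrow>as. g a :: 'a::comm_monoid_mult)"
  by (induction as) (simp_all add: mult_ac)

text \<open>The mixed term collects the sum of the diagonal factors n + 2 + c and n + 1 + c. The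
  three coefficients are the corrections to \<beta> and to the first two \<gamma>.\<close>

lemma shifted_euler_twice_R:
  "shifted_euler c (shifted_euler c (R as (n + 1))) =
     smult ((of_nat n + 2 + c)\<^sup>2) (R as (n + 1)) +
     smult ((of_nat n + 1) * (2 * of_nat n + 3 + 2 * c) * (\<Prod>a\<leftarrow>as. of_nat n + 1 + a)) (R as n) +
     (if n = 0 then 0 else smult (of_nat n * (of_nat n + 1) *
        (\<Prod>a\<leftarrow>as. (of_nat n + 1 + a) * (of_nat n + a))) (R as (n - 1)))"
proof -
  define p where "p = (\<Prod>a\<leftarrow>as. of_nat n + 1 + a)"
  define q where "q = (\<Prod>a\<leftarrow>as. of_nat n + a)"
  have "shifted_euler c (R as (n + 1)) = smult (of_nat n + 2 + c) (R as (n + 1)) + smult ((of_nat n + 1) * p) (R as n)"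
    unfolding p_def using shifted_euler_R[of c as n] by simp
  moreover have "shifted_euler c (R as n) = smult (of_nat n + 1 + c) (R as n) +
     (if n = 0 then 0 else smult (of_nat n * q) (R as (n - 1)))"
    unfolding q_def by (rule shifted_euler_R')
  ultimately show ?thesis
    unfolding prod_list_times p_def[symmetric] q_def[symmetric]
    by (auto intro!: poly_eqI simp: shifted_euler_add shifted_euler_smult power2_eq_square algebra_simps)
qed

text \<open>The upper index is an integer because -1 occurs for a single parameter. At m = n + 1 and
  m = n the corrections are the coefficients of R n and R (n - 1) in
  \<open>shifted_euler_twice_R\<close>.\<close>

definition gamma_tilde :: "complex \<Rightarrow> complex list \<Rightarrow> (int \<Rightarrow> nat \<Rightarrow> complex) \<Rightarrow> int \<Rightarrow> nat \<Rightarrow> complex" where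
  "gamma_tilde c as \<gamma> i m = \<gamma> i m
     - (if i = int (length as) - 1
        then of_nat m * (2 * of_nat m + 1 + 2 * c) * (\<Prod>a\<leftarrow>as. of_nat m + a) else 0)
     - (if i = int (length as) - 2
        then of_nat m * (of_nat m + 1) * (\<Prod>a\<leftarrow>as. (of_nat m + 1 + a) * (of_nat m + a)) else 0)"

lemma kl_map_recurrence:
  assumes d: "length as \<ge> 1"
    and rec: "[:0, 1:] * R as (n + 1) = R as (n + 2) + smult \<beta> (R as (n + 1)) +
      (\<Sum>\<nu>=0..length as - 1. if \<nu> \<le> n
        then smult (\<gamma> (int (length as) - 1 - int \<nu>) (n - \<nu> + 1)) (R as (n - \<nu>)) else 0)"
    and neg: "length as = 1 \<Longrightarrow> \<forall>n. \<gamma> (- 1) n = 0"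
  shows "kl_map c (R as (n + 2)) =
    [:- (\<beta> - (of_nat n + 2 + c)\<^sup>2), 1:] * kl_map c (R as (n + 1)) -
    (\<Sum>\<nu>=0..max (length as - 1) 1. if \<nu> \<le> n
      then smult (gamma_tilde c as \<gamma> (int (length as) - 1 - int \<nu>) (n - \<nu> + 1)) (kl_map c (R as (n - \<nu>))) else 0)"
proof -
  define M where "M = max (length as - 1) 1"
  let ?S = "\<lambda>n. kl_map c (R as n)"
  let ?i = "\<lambda>\<nu>. int (length as) - 1 - int \<nu>"
  define C0 where "C0 = (of_nat n + 1) * (2 * of_nat n + 3 + 2 * c) * (\<Prod>a\<leftarrow>as. of_nat n + 1 + a)"
  define C1 where "C1 = of_nat n * (of_nat n + 1) * (\<Prod>a\<leftarrow>as. (of_nat n + 1 + a) * (of_nat n + a))"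
  let ?D = "if n = 0 then 0 else smult C1 (?S (n - 1))"
  have kl_zero: "kl_map c 0 = 0" by (simp add: kl_map_def)
  \<comment> \<open>For a single parameter the transform creates a term \<nu> = 1 that the original
    recurrence lacks; the convention \<gamma>^{-1} = 0 lets both sums run up to M.\<close>
  have "(\<Sum>\<nu>=0..length as - 1. if \<nu> \<le> n then smult (\<gamma> (?i \<nu>) (n - \<nu> + 1)) (R as (n - \<nu>)) else 0) =
      (\<Sum>\<nu>=0..M. if \<nu> \<le> n then smult (\<gamma> (?i \<nu>) (n - \<nu> + 1)) (R as (n - \<nu>)) else 0)"
  proof (cases "length as = 1")
    case True
    then show ?thesis using neg by (simp add: M_def)
  next
    case False
    then have "M = length as - 1" using d by (simp add: M_def)
    then show ?thesis by simp
  qed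
  then have rec': "kl_map c ([:0, 1:] * R as (n + 1)) = ?S (n + 2) + smult \<beta> (?S (n + 1)) +
      (\<Sum>\<nu>=0..M. if \<nu> \<le> n then smult (\<gamma> (?i \<nu>) (n - \<nu> + 1)) (?S (n - \<nu>)) else 0)"
    unfolding rec by (simp add: kl_map_add kl_map_smult kl_map_sum if_distrib[of "kl_map c"] kl_zero cong: if_cong)
  have euler: "kl_map c (shifted_euler c (shifted_euler c (R as (n + 1)))) =
      smult ((of_nat n + 2 + c)\<^sup>2) (?S (n + 1)) + smult C0 (?S n) + ?D"
    unfolding shifted_euler_twice_R C0_def C1_def by (simp add: kl_map_add kl_map_smult kl_zero)
  have "(\<Sum>\<nu>=0..M. if \<nu> \<le> n then smult (gamma_tilde c as \<gamma> (?i \<nu>) (n - \<nu> + 1)) (?S (n - \<nu>)) else 0) =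
      (\<Sum>\<nu>=0..M. (if \<nu> \<le> n then smult (\<gamma> (?i \<nu>) (n - \<nu> + 1)) (?S (n - \<nu>)) else 0)
         - (if \<nu> = 0 then smult C0 (?S n) else 0) - (if \<nu> = 1 then ?D else 0))"
  proof (rule sum.cong[OF refl])
    fix \<nu> :: nat
    consider "\<nu> = 0" | "\<nu> = 1" | "\<nu> > 1" by linarith
    then show "(if \<nu> \<le> n then smult (gamma_tilde c as \<gamma> (?i \<nu>) (n - \<nu> + 1)) (?S (n - \<nu>)) else 0) =
      (if \<nu> \<le> n then smult (\<gamma> (?i \<nu>) (n - \<nu> + 1)) (?S (n - \<nu>)) else 0)
         - (if \<nu> = 0 then smult C0 (?S n) else 0) - (if \<nu> = 1 then ?D else 0)"
    proof cases
      case 1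
      have "of_nat (n + 1) * (2 * of_nat (n + 1) + 1 + 2 * c) * (\<Prod>a\<leftarrow>as. of_nat (n + 1) + a) = C0"
        by (simp add: C0_def algebra_simps)
      then show ?thesis
        by (simp add: 1 gamma_tilde_def smult_diff_left del: of_nat_Suc of_nat_add)
    next
      case 2
      then show ?thesis
        by (cases n) (auto simp: gamma_tilde_def C1_def smult_diff_left simp del: of_nat_Suc)
    next
      case 3
      then show ?thesis by (simp add: gamma_tilde_def)
    qed
  qed
  \<comment> \<open>M \<ge> 1, so both correction terms lie within the range of summation.\<close>
  also have "\<dots> = (\<Sum>\<nu>=0..M. if \<nu> \<le> n then smult (\<gamma> (?i \<nu>) (n - \<nu> + 1)) (?S (n - \<nu>)) else 0)
      - smult C0 (?S n) - ?D"
    by (simp only: sum_subtractf) (simp add: M_def)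
  finally have "(\<Sum>\<nu>=0..M. if \<nu> \<le> n then smult (gamma_tilde c as \<gamma> (?i \<nu>) (n - \<nu> + 1)) (?S (n - \<nu>)) else 0) =
      (\<Sum>\<nu>=0..M. if \<nu> \<le> n then smult (\<gamma> (?i \<nu>) (n - \<nu> + 1)) (?S (n - \<nu>)) else 0)
      - smult C0 (?S n) - ?D" .
  moreover have "[:- (\<beta> - (of_nat n + 2 + c)\<^sup>2), 1:] * ?S (n + 1) =
      [:0, 1:] * ?S (n + 1) - smult \<beta> (?S (n + 1)) + smult ((of_nat n + 2 + c)\<^sup>2) (?S (n + 1))"
    by (simp add: smult_diff_left algebra_simps)
  moreover have "[:0, 1:] * ?S (n + 1) = ?S (n + 2) + smult \<beta> (?S (n + 1)) +
      (\<Sum>\<nu>=0..M. if \<nu> \<le> n then smult (\<gamma> (?i \<nu>) (n - \<nu> + 1)) (?S (n - \<nu>)) else 0) -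
      (smult ((of_nat n + 2 + c)\<^sup>2) (?S (n + 1)) + smult C0 (?S n) + ?D)"
    unfolding mult_kl_map[of c "R as (n + 1)"] rec' euler ..
  moreover have "p = (p + b + g - (s + a + d)) - b + s - (g - a - d)" for p b g s a d :: "complex poly"
    by simp
  ultimately show ?thesis
    unfolding M_def[symmetric] by (simp only:)
qed

text \<open>For at least three parameters the last term has \<nu> \<ge> 2, beyond the reach of the
  corrections, so it equals the original lowest coefficient, which
  \<open>dual_partial_shift_lowest\<close> shows to be nonzero.\<close>

lemma gamma_tilde_last_neq_0:
  assumes adm: "\<forall>a\<in>set as. \<forall>k::nat. k \<ge> 1 \<longrightarrow> - a \<noteq> of_nat k"
    and d: "length as \<ge> 3" and n: "n + 1 \<ge> length as"
    and rec: "[:0, 1:] * R as (n + 1) = R as (n + 2) + smult \<beta> (R as (n + 1)) +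
      (\<Sum>\<nu>=0..length as - 1. if \<nu> \<le> n
        then smult (\<gamma> (int (length as) - 1 - int \<nu>) (n - \<nu> + 1)) (R as (n - \<nu>)) else 0)"
  shows "gamma_tilde c as \<gamma> 0 (n - (length as - 1) + 1) \<noteq> 0"
proof -
  define j where "j = n - (length as - 1)"
  obtain w where w: "Vector_Spaces.linear smult (*) w" "\<And>n. w (R as n) = (if n = j then 1 else 0)"
    using dual_functional_exists[of "R as" j] degree_R[OF adm] lead_coeff_R[OF adm]
    by (metis leading_coeff_0_iff zero_neq_one)
  have "\<gamma> (int (length as) - 1 - int (length as - 1)) (n - (length as - 1) + 1) =
      w (partial_shift as as (n + 1)) / lam as (n + 1)"
    by (rule R_recurrence_coeff[OF adm w rec]) (use d n in \<open>auto simp: j_def\<close>)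
  moreover have "n + 1 = j + length as" using d n by (simp add: j_def)
  ultimately have "\<gamma> 0 (n - (length as - 1) + 1) \<noteq> 0"
    using dual_partial_shift_lowest[OF adm w, of as] lam_neq_0[OF adm] d by (simp add: of_nat_diff)
  then show ?thesis using d by (simp add: gamma_tilde_def)
qed

text \<open>For two parameters the correction at \<nu> = 1 cancels the original coefficient exactly,
  leaving three terms. At \<nu> = 0 the factors 3n + 3 + a + b and 2n + 3 + 2c subtract to n + a + b
  - 2c.\<close>

lemma gamma_tilde_two:
  assumes adm: "\<forall>a\<in>set [a, b]. \<forall>k::nat. k \<ge> 1 \<longrightarrow> - a \<noteq> of_nat k"
    and rec: "[:0, 1:] * R [a, b] (n + 1) = R [a, b] (n + 2) + smult \<beta> (R [a, b] (n + 1)) +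
      (\<Sum>\<nu>=0..length [a, b] - 1. if \<nu> \<le> n
        then smult (\<gamma> (int (length [a, b]) - 1 - int \<nu>) (n - \<nu> + 1)) (R [a, b] (n - \<nu>)) else 0)"
  shows "gamma_tilde c [a, b] \<gamma> 1 (n + 1) =
      (of_nat n + 1) * (of_nat n + 1 + a) * (of_nat n + 1 + b) * (of_nat n + a + b - 2 * c)"
    and "n \<ge> 1 \<Longrightarrow> gamma_tilde c [a, b] \<gamma> 0 n = 0"
proof -
  have w_ex: "\<exists>w. Vector_Spaces.linear smult (*) w \<and> (\<forall>n. w (R [a, b] n) = (if n = j then 1 else 0))" for j
    using dual_functional_exists[of "R [a, b]" j] degree_R[OF adm] lead_coeff_R[OF adm]
    by (metis leading_coeff_0_iff zero_neq_one)
  have lam0: "lam [a, b] n \<noteq> 0" for n by (rule lam_neq_0[OF adm])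
  have lam_Suc: "lam [a, b] m = - ((of_nat m + 1 + a) * (of_nat m + 1 + b)) * lam [a, b] (Suc m)" for m
    using lam_eq_lam_Suc[OF adm, of m] by simp
  obtain w where w: "Vector_Spaces.linear smult (*) w" "\<And>m. w (R [a, b] m) = (if m = n then 1 else 0)"
    using w_ex[of n] by metis
  note cons = dual_partial_shift_Cons[OF adm w] and nil = dual_partial_shift_Nil[OF adm w]
  \<comment> \<open>The factor n absorbs the truncation of \<open>n - 1\<close> at n = 0.\<close>
  have "of_nat n * w (partial_shift [a, b] [] (n - 1)) = - of_nat n * lam [a, b] n"
    by (cases n) (simp_all add: nil ring_distribs)
  then have b_n: "w (partial_shift [a, b] [b] n) = (2 * of_nat n + 1 + b) * lam [a, b] n"
    unfolding cons by (simp add: nil algebra_simps)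
  have b_Suc: "w (partial_shift [a, b] [b] (n + 1)) = - (of_nat n + 1) * lam [a, b] n"
    unfolding cons by (simp add: nil ring_distribs)
  have "\<gamma> (int (length [a, b]) - 1 - int 0) (n - 0 + 1) =
      w (partial_shift [a, b] [a, b] (n + 1)) / lam [a, b] (n + 1)"
    by (rule R_recurrence_coeff[OF adm w rec]) auto
  also have "w (partial_shift [a, b] [a, b] (n + 1)) =
      - ((of_nat n + 1) * (3 * of_nat n + 3 + a + b) * lam [a, b] n)"
    unfolding cons[of a] b_Suc by (simp add: b_n algebra_simps)
  also have "\<dots> / lam [a, b] (n + 1) =
      (of_nat n + 1) * (3 * of_nat n + 3 + a + b) * ((of_nat n + 1 + a) * (of_nat n + 1 + b))"
    unfolding lam_Suc[of n] using lam0[of "Suc n"] by simp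
  finally show "gamma_tilde c [a, b] \<gamma> 1 (n + 1) =
      (of_nat n + 1) * (of_nat n + 1 + a) * (of_nat n + 1 + b) * (of_nat n + a + b - 2 * c)"
    by (simp add: gamma_tilde_def algebra_simps)
  assume "n \<ge> 1"
  then obtain m where m: "n = Suc m" by (cases n) auto
  \<comment> \<open>For \<nu> = 1 the coefficient sits at R (n - 1), so the functional dual to index
    m = n - 1 is needed.\<close>
  obtain v where v: "Vector_Spaces.linear smult (*) v" "\<And>n. v (R [a, b] n) = (if n = m then 1 else 0)"
    using w_ex[of m] by metis
  note cons = dual_partial_shift_Cons[OF adm v] and nil = dual_partial_shift_Nil[OF adm v]
  have "\<gamma> (int (length [a, b]) - 1 - int 1) (n - 1 + 1) =
      v (partial_shift [a, b] [a, b] (n + 1)) / lam [a, b] (n + 1)"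
    by (rule R_recurrence_coeff[OF adm v rec]) (auto simp: m)
  also have "v (partial_shift [a, b] [a, b] (n + 1)) = (of_nat n + 1) * of_nat n * lam [a, b] m"
    unfolding cons by (simp add: nil m)
  also have "\<dots> / lam [a, b] (n + 1) = (of_nat n + 1) * of_nat n *
      ((of_nat n + a) * (of_nat n + b) * ((of_nat n + 1 + a) * (of_nat n + 1 + b)))"
    unfolding lam_Suc[of m] m[symmetric] lam_Suc[of n] using lam0[of "Suc n"] by (simp add: m add_ac)
  finally show "gamma_tilde c [a, b] \<gamma> 0 n = 0"
    by (simp add: gamma_tilde_def m algebra_simps)
qed

text \<open>The image of x^k under the transform contributes exactly the two Pochhammer symbols of
  the new upper parameters; the series stops at n because of the parameter -n.\<close>

lemma poly_kl_map_R:
  "poly (kl_map c (R as n)) (\<tau>\<^sup>2 / 4) = 1 / lam as n *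
      pFq [- of_nat n, c + 1 - \<i> * \<tau> / 2, c + 1 + \<i> * \<tau> / 2]
        (map (\<lambda>a. a + 1) as) 1"
proof -
  let ?F = "fps_hypergeo [- of_nat n, c + 1 - \<i> * \<tau> / 2, c + 1 + \<i> * \<tau> / 2]
        (map (\<lambda>a. a + 1) as) (1::complex)"
  have "(\<lambda>k. fps_nth ?F k * 1 ^ k) sums (\<Sum>k\<le>n. fps_nth ?F k * 1 ^ k)"
    by (rule sums_finite) (auto simp: pochhammer_of_nat_eq_0_lemma)
  then have "pFq [- of_nat n, c + 1 - \<i> * \<tau> / 2, c + 1 + \<i> * \<tau> / 2]
        (map (\<lambda>a. a + 1) as) 1 = (\<Sum>k\<le>n. fps_nth ?F k)"
    by (simp only: pFq_def eval_fps_def sums_iff power_one mult_1_right)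
  moreover have "degree (R as n) \<le> n"
    by (rule degree_le) (simp add: coeff_R pochhammer_of_nat_eq_0_lemma)
  ultimately show ?thesis
    by (simp add: kl_map_def monomial_map_altdef[of _ n] poly_sum poly_kl_basis coeff_R inverse_lam
        foldl_pochhammer sum_distrib_left mult_ac)
qed

theorem lemma4p2:
  fixes \<alpha> :: real and d :: nat and \<alpha>s :: "complex list"
    and \<beta> :: "nat \<Rightarrow> complex" and \<gamma> :: "int \<Rightarrow> nat \<Rightarrow> complex"
  assumes "\<alpha> \<ge> 0" and "d \<ge> 1" and "length \<alpha>s = d"
    and "\<forall>a\<in>set \<alpha>s. \<forall>k::nat. k \<ge> 1 \<longrightarrow> - a \<noteq> of_nat k"
    and rec_R: "\<forall>n x. poly (R \<alpha>s (n + 2)) x =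
          (x - \<beta> (n + 1)) * poly (R \<alpha>s (n + 1)) x
          - (\<Sum>\<nu>=0..d-1. if \<nu> \<le> n
               then \<gamma> (int d - 1 - int \<nu>) (n - \<nu> + 1) * poly (R \<alpha>s (n - \<nu>)) x else 0)"
    and "d = 1 \<Longrightarrow> \<forall>n. \<gamma> (- 1) n = 0"
  shows
    "(\<forall>n. \<forall>\<tau>>0. poly (S \<alpha> \<alpha>s n) (of_real (\<tau>\<^sup>2 / 4)) =
                  KL \<alpha> (\<lambda>x. poly (R \<alpha>s n) (of_real x)) \<tau>) \<and>
     (\<forall>n. \<forall>\<tau>::complex. poly (S \<alpha> \<alpha>s n) (\<tau>\<^sup>2 / 4) =
        1 / lam \<alpha>s n *
        pFq [- of_nat n, of_real \<alpha> + 1 - \<i> * \<tau> / 2, of_real \<alpha> + 1 + \<i> * \<tau> / 2]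
            (map (\<lambda>a. a + 1) \<alpha>s) 1) \<and>
     (\<forall>n. degree (S \<alpha> \<alpha>s n) = n \<and> lead_coeff (S \<alpha> \<alpha>s n) = 1) \<and>
     (regular_parameters \<alpha> \<alpha>s \<longrightarrow> m_orthogonal (d_tilde d) (S \<alpha> \<alpha>s)) \<and>
     (\<exists>(\<beta>t :: nat \<Rightarrow> complex) (\<gamma>t :: int \<Rightarrow> nat \<Rightarrow> complex).
        (\<forall>n. \<forall>\<tau>::complex. poly (S \<alpha> \<alpha>s (n + 2)) (\<tau>\<^sup>2 / 4) =
           (\<tau>\<^sup>2 / 4 - \<beta>t (n + 1)) * poly (S \<alpha> \<alpha>s (n + 1)) (\<tau>\<^sup>2 / 4)
           - (\<Sum>\<nu>=0..max (d-1) 1. if \<nu> \<le> n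
                then \<gamma>t (int d - 1 - int \<nu>) (n - \<nu> + 1) * poly (S \<alpha> \<alpha>s (n - \<nu>)) (\<tau>\<^sup>2 / 4)
                else 0)) \<and>
        (\<forall>n. \<beta>t (n + 1) = \<beta> (n + 1) - (of_nat n + 2 + of_real \<alpha>)\<^sup>2) \<and>
        (\<forall>n. \<gamma>t (int d - 1) (n + 1) = \<gamma> (int d - 1) (n + 1)
           - (of_nat n + 1) * (2 * of_nat n + 3 + 2 * of_real \<alpha>)
             * (\<Prod>a\<leftarrow>\<alpha>s. of_nat n + 1 + a)) \<and>
        (\<forall>n\<ge>1. \<gamma>t (int d - 2) n = \<gamma> (int d - 2) n
           - of_nat n * (of_nat n + 1) * (\<Prod>a\<leftarrow>\<alpha>s. (of_nat n + 1 + a) * (of_nat n + a))) \<and>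
        (\<forall>\<nu>\<in>{2..d-1}. \<forall>n\<ge>\<nu>.
           \<gamma>t (int d - 1 - int \<nu>) (n - \<nu> + 1) = \<gamma> (int d - 1 - int \<nu>) (n - \<nu> + 1))) \<and>
     (\<forall>(a::real) (as :: complex list).
        a \<ge> 1 \<and> length as = d \<and>
        (\<forall>b\<in>set as. \<forall>k::nat. k \<ge> 1 \<longrightarrow> - (of_real a + b - 1) \<noteq> of_nat k) \<longrightarrow>
        (\<forall>n. \<forall>\<tau>::complex. \<tau> \<noteq> 0 \<longrightarrow>
           central_diff \<i> (\<lambda>t. poly (S_hat a as (n + 1)) (t\<^sup>2 / 4)) \<tau> =
           (of_nat n + 1) / 2 *
             poly (S_hat (a + 1/2) (map (\<lambda>b. b + 1/2) as) n) (\<tau>\<^sup>2 / 4)))"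
proof -
  let ?c = "of_real \<alpha> :: complex"
  let ?P = "\<lambda>n. kl_map ?c (R \<alpha>s n)"
  have len: "length \<alpha>s = d" and d: "d \<ge> 1" and adm: "\<forall>a\<in>set \<alpha>s. \<forall>k::nat. k \<ge> 1 \<longrightarrow> - a \<noteq> of_nat k"
    by fact+
  have S: "S \<alpha> \<alpha>s n = ?P n" for n
    unfolding S_def KL_poly_eq_kl_map[OF \<open>\<alpha> \<ge> 0\<close>] ..
  have deg: "degree (?P n) = n" and lead: "lead_coeff (?P n) = 1" and nz: "?P n \<noteq> 0" for n
  proof -
    show "degree (?P n) = n"
      by (rule trans[OF degree_kl_map degree_R[OF adm]])
    show "lead_coeff (?P n) = 1"
      by (rule trans[OF lead_coeff_kl_map lead_coeff_R[OF adm]])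
    then show "?P n \<noteq> 0" by (metis leading_coeff_0_iff zero_neq_one)
  qed
  \<comment> \<open>The pointwise hypothesis as an identity of polynomials, solved for x R (n +
    1).\<close>
  have rec: "[:0, 1:] * R \<alpha>s (n + 1) = R \<alpha>s (n + 2) + smult (\<beta> (n + 1)) (R \<alpha>s (n + 1)) +
      (\<Sum>\<nu>=0..length \<alpha>s - 1. if \<nu> \<le> n
        then smult (\<gamma> (int (length \<alpha>s) - 1 - int \<nu>) (n - \<nu> + 1)) (R \<alpha>s (n - \<nu>)) else 0)" for n
  proof -
    have "poly ([:0, 1:] * R \<alpha>s (n + 1)) x = poly (R \<alpha>s (n + 2) + smult (\<beta> (n + 1)) (R \<alpha>s (n + 1)) +
      (\<Sum>\<nu>=0..length \<alpha>s - 1. if \<nu> \<le> n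
        then smult (\<gamma> (int (length \<alpha>s) - 1 - int \<nu>) (n - \<nu> + 1)) (R \<alpha>s (n - \<nu>)) else 0)) x" for x
      unfolding poly_add poly_mult poly_smult poly_sum rec_R[rule_format] len if_distrib[of "\<lambda>p. poly p x"] poly_0
      by (simp add: algebra_simps)
    then show ?thesis by (rule poly_eq_poly_eq_iff[THEN iffD1, OF ext])
  qed
  define \<gamma>t where "\<gamma>t = gamma_tilde ?c \<alpha>s \<gamma>"
  define \<beta>t where "\<beta>t n = \<beta> n - (of_nat n + 1 + ?c)\<^sup>2" for n
  have \<beta>t: "\<beta>t (n + 1) = \<beta> (n + 1) - (of_nat n + 2 + ?c)\<^sup>2" for n
    by (simp add: \<beta>t_def add_ac)
  have recS: "?P (n + 2) = [:- \<beta>t (n + 1), 1:] * ?P (n + 1) -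
      (\<Sum>\<nu>=0..max (d - 1) 1. if \<nu> \<le> n
        then smult (\<gamma>t (int d - 1 - int \<nu>) (n - \<nu> + 1)) (?P (n - \<nu>)) else 0)" for n
    unfolding \<gamma>t_def \<beta>t len[symmetric]
    by (rule kl_map_recurrence[OF _ rec]) (use d len assms(6) in auto)

  \<comment> \<open>Multiple orthogonality of the transformed sequence\<close>
  have ortho: "m_orthogonal (d_tilde d) ?P" if reg: "regular_parameters \<alpha> \<alpha>s"
  proof -
    \<comment> \<open>Far enough out the guard \<nu> \<le> n always holds, which gives the form
      required by \<open>m_orthogonal_if_recurrence\<close>.\<close>
    have truncate: "(\<Sum>\<nu>=0..m - 1. if \<nu> \<le> n then f \<nu> else 0) = (\<Sum>\<nu><m. f \<nu>)"
      if "m \<ge> 1" "n + 1 \<ge> m" for m n and f :: "nat \<Rightarrow> complex poly"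
    proof -
      have "{0..m - 1} = {..<m}" using that by auto
      then show ?thesis using that by (auto intro!: sum.cong)
    qed
    \<comment> \<open>The order is one more than the index \<nu> of the last nonzero coefficient:
      \<nu> = 1 for d = 1, \<nu> = 0 for d = 2, and \<nu> = d - 1 from d = 3 on.\<close>
    consider "d = 1" | "d = 2" | "d \<ge> 3" using d by linarith
    then show ?thesis
    proof cases
      case 1
      have max: "max (d - 1) 1 = 2 - 1" using 1 by simp
      have "m_orthogonal 2 ?P"
      proof (rule m_orthogonal_if_recurrence[where b = "\<lambda>n. \<beta>t (n + 1)"
            and c = "\<lambda>n \<nu>. \<gamma>t (int d - 1 - int \<nu>) (n - \<nu> + 1)"])
        fix n :: nat assume n: "2 \<le> n + 1"
        show "?P (n + 2) = [:- \<beta>t (n + 1), 1:] * ?P (n + 1)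
            - (\<Sum>\<nu><2. smult (\<gamma>t (int d - 1 - int \<nu>) (n - \<nu> + 1)) (?P (n - \<nu>)))"
          unfolding recS max truncate[OF one_le_numeral n] ..
        from n obtain k where k: "n = Suc k" by (cases n) auto
        \<comment> \<open>Since \<gamma>^{-1} = 0, the last coefficient is minus the correction
          term; its factors are nonzero by admissibility at n and at n - 1.\<close>
        have "(\<Prod>a\<leftarrow>\<alpha>s. (of_nat n + 1 + a) * (of_nat n + a)) \<noteq> 0"
          using prod_list_shift_neq_0[OF adm, of n] prod_list_shift_neq_0[OF adm, of k]
          unfolding prod_list_times by (simp add: k add_ac)
        then show "\<gamma>t (int d - 1 - int (2 - 1)) (n - (2 - 1) + 1) \<noteq> 0"
          using assms(6) 1 len by (simp add: \<gamma>t_def gamma_tilde_def k del: of_nat_Suc)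
            (metis of_nat_Suc of_nat_neq_0 add.commute)
      qed (use deg nz in auto)
      then show ?thesis by (simp add: d_tilde_def 1)
    next
      case 2
      then obtain a b where ab: "\<alpha>s = [a, b]"
        using len by (auto simp: numeral_2_eq_2 length_Suc_conv)
      note two = gamma_tilde_two[where c = ?c, OF adm[unfolded ab] rec[unfolded ab], folded ab, folded \<gamma>t_def]
      have "m_orthogonal 1 ?P"
      proof (rule m_orthogonal_if_recurrence[where b = "\<lambda>n. \<beta>t (n + 1)"
            and c = "\<lambda>n \<nu>. \<gamma>t 1 (n + 1)"])
        fix n :: nat
        have "\<gamma>t 0 n = 0" if "1 \<le> n" using two(2)[OF that] .
        then show "?P (n + 2) = [:- \<beta>t (n + 1), 1:] * ?P (n + 1)
            - (\<Sum>\<nu><1. smult (\<gamma>t 1 (n + 1)) (?P (n - \<nu>)))"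
          unfolding recS using 2 by simp
        \<comment> \<open>The one factor that admissibility does not control; this is what
          \<open>regular_parameters\<close> excludes.\<close>
        have "of_nat n + sum_list \<alpha>s - 2 * ?c \<noteq> 0"
          using reg 2 len unfolding regular_parameters_def by blast
        moreover have "(\<Prod>a\<leftarrow>\<alpha>s. of_nat n + 1 + a) \<noteq> 0"
          by (rule prod_list_shift_neq_0[OF adm])
        moreover have "of_nat n + 1 \<noteq> (0 :: complex)"
          by (metis of_nat_Suc of_nat_neq_0 add.commute)
        ultimately show "\<gamma>t 1 (n + 1) \<noteq> 0"
          unfolding two(1) by (simp add: ab add_ac)
      qed (use deg nz in auto)
      then show ?thesis by (simp add: d_tilde_def 2)
    next
      case 3
      have max: "max (d - 1) 1 = d - 1" using 3 by simp
      have "m_orthogonal d ?P"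
      proof (rule m_orthogonal_if_recurrence[where b = "\<lambda>n. \<beta>t (n + 1)"
            and c = "\<lambda>n \<nu>. \<gamma>t (int d - 1 - int \<nu>) (n - \<nu> + 1)"])
        fix n :: nat assume n: "d \<le> n + 1"
        show "?P (n + 2) = [:- \<beta>t (n + 1), 1:] * ?P (n + 1)
            - (\<Sum>\<nu><d. smult (\<gamma>t (int d - 1 - int \<nu>) (n - \<nu> + 1)) (?P (n - \<nu>)))"
          unfolding recS max truncate[OF d n] ..
        show "\<gamma>t (int d - 1 - int (d - 1)) (n - (d - 1) + 1) \<noteq> 0"
          using gamma_tilde_last_neq_0[OF adm _ _ rec, of n ?c] 3 n len by (simp add: \<gamma>t_def of_nat_diff)
      qed (use deg nz 3 in auto)
      then show ?thesis using 3 by (simp add: d_tilde_def)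
    qed
  qed

  \<comment> \<open>Pointwise recurrence and the explicit coefficients\<close>
  have recS_poly: "poly (?P (n + 2)) x = (x - \<beta>t (n + 1)) * poly (?P (n + 1)) x -
      (\<Sum>\<nu>=0..max (d - 1) 1. if \<nu> \<le> n
        then \<gamma>t (int d - 1 - int \<nu>) (n - \<nu> + 1) * poly (?P (n - \<nu>)) x else 0)" for n x
    unfolding recS poly_diff poly_mult poly_sum if_distrib[of "\<lambda>p. poly p x"] poly_0 poly_smult by simp
  have \<gamma>t_0: "\<gamma>t (int d - 1) (n + 1) = \<gamma> (int d - 1) (n + 1)
      - (of_nat n + 1) * (2 * of_nat n + 3 + 2 * ?c) * (\<Prod>a\<leftarrow>\<alpha>s. of_nat n + 1 + a)" for n
  proof -
    have "of_nat (n + 1) = of_nat n + (1 :: complex)" "2 * (of_nat n + 1) + 1 + 2 * ?c = 2 * of_nat n + 3 + 2 * ?c"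
      by simp_all
    then show ?thesis
      by (simp only: \<gamma>t_def gamma_tilde_def len) simp
  qed
  have \<gamma>t_1: "\<gamma>t (int d - 2) n = \<gamma> (int d - 2) n
      - of_nat n * (of_nat n + 1) * (\<Prod>a\<leftarrow>\<alpha>s. (of_nat n + 1 + a) * (of_nat n + a))" for n
    by (simp add: \<gamma>t_def gamma_tilde_def len)
  have \<gamma>t_ge2: "\<gamma>t (int d - 1 - int \<nu>) m = \<gamma> (int d - 1 - int \<nu>) m" if "\<nu> \<ge> 2" for \<nu> m
    using that by (simp add: \<gamma>t_def gamma_tilde_def len)

  \<comment> \<open>Central differences of the reparametrised sequence\<close>
  have diff: "central_diff \<i> (\<lambda>t. poly (S_hat a as (n + 1)) (t\<^sup>2 / 4)) \<tau> =
      (of_nat n + 1) / 2 * poly (S_hat (a + 1/2) (map (\<lambda>b. b + 1/2) as) n) (\<tau>\<^sup>2 / 4)"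
    if a: "a \<ge> 1" and adm': "\<forall>b\<in>set as. \<forall>k::nat. k \<ge> 1 \<longrightarrow> - (of_real a + b - 1) \<noteq> of_nat k"
      and \<tau>: "\<tau> \<noteq> 0" for a :: real and as n and \<tau> :: complex
  proof -
    define as' where "as' = map (\<lambda>b. of_real a + b - 1) as"
    have adm'': "\<forall>b\<in>set as'. \<forall>k::nat. k \<ge> 1 \<longrightarrow> - b \<noteq> of_nat k"
      using adm' by (auto simp: as'_def)
    have 1: "S_hat a as (n + 1) = kl_map (of_real (a - 1)) (R as' (Suc n))"
      unfolding S_hat_def S_def as'_def using a by (subst KL_poly_eq_kl_map) auto
    \<comment> \<open>Raising a and every b by 1/2 raises \<alpha> = a - 1 by 1/2 but each parameter
      a + b - 1 by 1: precisely the shifts of \<open>central_diff_kl_map\<close> and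
      \<open>pderiv_R\<close>.\<close>
    have "map (\<lambda>b. of_real (a + 1/2) + b - 1) (map (\<lambda>b. b + 1/2) as) = map (\<lambda>a. a + 1) as'"
      by (simp add: as'_def)
    moreover have "complex_of_real (a + 1/2 - 1) = of_real (a - 1) + 1 / 2"
      by simp
    ultimately have 2: "S_hat (a + 1/2) (map (\<lambda>b. b + 1/2) as) n =
        kl_map (of_real (a - 1) + 1 / 2) (R (map (\<lambda>a. a + 1) as') n)"
      unfolding S_hat_def S_def using a by (subst KL_poly_eq_kl_map) auto
    show ?thesis
      unfolding 1 2 central_diff_kl_map[OF \<tau>] pderiv_R[OF adm''] kl_map_smult poly_smult
      by simp
  qed

  show ?thesis
    unfolding S
  proof (intro conjI allI impI)
    show "\<exists>(\<beta>t :: nat \<Rightarrow> complex) (\<gamma>t :: int \<Rightarrow> nat \<Rightarrow> complex).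
        (\<forall>n. \<forall>\<tau>::complex. poly (?P (n + 2)) (\<tau>\<^sup>2 / 4) =
           (\<tau>\<^sup>2 / 4 - \<beta>t (n + 1)) * poly (?P (n + 1)) (\<tau>\<^sup>2 / 4)
           - (\<Sum>\<nu>=0..max (d-1) 1. if \<nu> \<le> n
                then \<gamma>t (int d - 1 - int \<nu>) (n - \<nu> + 1) * poly (?P (n - \<nu>)) (\<tau>\<^sup>2 / 4)
                else 0)) \<and>
        (\<forall>n. \<beta>t (n + 1) = \<beta> (n + 1) - (of_nat n + 2 + of_real \<alpha>)\<^sup>2) \<and>
        (\<forall>n. \<gamma>t (int d - 1) (n + 1) = \<gamma> (int d - 1) (n + 1)
           - (of_nat n + 1) * (2 * of_nat n + 3 + 2 * of_real \<alpha>)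
             * (\<Prod>a\<leftarrow>\<alpha>s. of_nat n + 1 + a)) \<and>
        (\<forall>n\<ge>1. \<gamma>t (int d - 2) n = \<gamma> (int d - 2) n
           - of_nat n * (of_nat n + 1) * (\<Prod>a\<leftarrow>\<alpha>s. (of_nat n + 1 + a) * (of_nat n + a))) \<and>
        (\<forall>\<nu>\<in>{2..d-1}. \<forall>n\<ge>\<nu>.
           \<gamma>t (int d - 1 - int \<nu>) (n - \<nu> + 1) = \<gamma> (int d - 1 - int \<nu>) (n - \<nu> + 1))"
      by (intro exI[of _ \<beta>t] exI[of _ \<gamma>t] conjI allI impI ballI) (simp_all only: recS_poly \<beta>t \<gamma>t_0 \<gamma>t_1 \<gamma>t_ge2 atLeastAtMost_iff)
  qed (use KL_poly_values[OF \<open>\<alpha> \<ge> 0\<close>] poly_kl_map_R deg lead ortho diff in auto)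
qed

end
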